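(* Let $A\in\mathbb{R}^{m\times n}$ have rank $r$, let $b\in\mathbb{R}^m$, and let $M\in\mathbb{R}^{m\times m}$, $N\in\mathbb{R}^{n\times n}$ be symmetric positive definite with $M^{-1}=L_M^{\top}L_M$ and $N^{-1}=L_N^{\top}L_N$ (Cholesky factorizations). Let $U_A=(u_{A,1},\dots,u_{A,m})$, $\sigma_1\ge\dots\ge\sigma_r>0$, $Z=(z_1,\dots,z_n)$ be given by the normalized GSVD of $\{L_MA,L_N\}$, with generalized singular values $\gamma_i=\sigma_i$ for $1\le i\le r$. Let $k\ge1$ and suppose the generalized Golub-Kahan bidiagonalization (gen-GKB) of $A$ with starting vector $b$ does not terminate in $k$ steps, i.e. $\alpha_i,\beta_i\neq 0$ for $1\le i\le k+1$. Then the $k$-th regularized solution $x_k$ computed by genGKB\_SPR has the expression $$x_k=\sum_{i=1}^{r}f_i^{(k)}\frac{u_{A,i}^{\top}L_Mb}{\sigma_i}z_i$$ with filter factors $$f_i^{(k)}=1-\prod_{j=1}^{k}\frac{(\theta_j^{(k)})^2-\gamma_i^2}{(\theta_j^{(k)})^2},\qquad i=1,\dots,r,$$ where $\theta_1^{(k)}>\theta_2^{(k)}>\cdots>\theta_k^{(k)}>0$ are the singular values of the bidiagonal matrix $B_k$ generated by gen-GKB.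
   Context: For symmetric positive definite $B$, $\|x\|_B=(x^{\top}Bx)^{1/2}$. Normalized GSVD of $\{L_MA,L_N\}$: $L_MA=U_A\Sigma_AZ^{-1}$ and $L_N=U_LZ^{-1}$, where $U_A\in\mathbb{R}^{m\times m}$ and $U_L\in\mathbb{R}^{n\times n}$ are orthogonal, $Z\in\mathbb{R}^{n\times n}$ is invertible with $N^{-1}$-orthonormal columns ($Z^{\top}N^{-1}Z=I$), and $\Sigma_A=\begin{pmatrix}D_A&0\\0&0\end{pmatrix}\in\mathbb{R}^{m\times n}$ with $D_A=\mathrm{diag}(\sigma_1,\dots,\sigma_r)$. Gen-GKB: with $A^{*}=NA^{\top}M^{-1}$, vectors $u_i\in\mathbb{R}^m$, $v_i\in\mathbb{R}^n$ and scalars $\alpha_i,\beta_i\ge 0$ are generated by $$\beta_1u_1=b,\qquad \alpha_i v_i = A^{*}u_i-\beta_i v_{i-1},\qquad \beta_{i+1}u_{i+1}=Av_i-\alpha_i u_i\qquad (i=1,2,\dots),$$ with $v_0=0$, where $\alpha_i,\beta_i$ are the normalization constants such that $\|u_i\|_{M^{-1}}=\|v_i\|_{N^{-1}}=1$. Put $V_k=(v_1,\dots,v_k)$ and let $B_k\in\mathbb{R}^{(k+1)\times k}$ be the lower bidiagonal matrix with $(B_k)_{i,i}=\alpha_i$ and $(B_k)_{i+1,i}=\beta_{i+1}$ for $1\le i\le k$, all other entries being zero. genGKB\_SPR: its $k$-th regularized solution is $x_k=V_ky_k$, where $y_k=\operatorname{argmin}_{y\in\mathbb{R}^k}\|B_ky-\beta_1e_1\|_2$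 and $e_1$ is the first column of the identity matrix of order $k+1$ (equivalently, $x_k$ minimizes $\|Ax-b\|_{M^{-1}}$ over $x\in\mathrm{span}\{v_1,\dots,v_k\}$). *)

theory Defs
  imports
    "Jordan_Normal_Form.Char_Poly"
    "Jordan_Normal_Form.DL_Rank"
    "HOL-Computational_Algebra.Computational_Algebra"
begin

definition minv :: "real mat \<Rightarrow> real mat" where
  "minv A = the (mat_inverse A)"

definition sym_pos_def :: "nat \<Rightarrow> real mat \<Rightarrow> bool" where
  "sym_pos_def n B \<longleftrightarrow>
     B \<in> carrier_mat n n \<and> B\<^sup>T = B \<and> (\<forall>x \<in> carrier_vec n. x \<noteq> 0\<^sub>v n \<longrightarrow> x \<bullet> (B *\<^sub>v x) > 0)"

definition cholesky :: "nat \<Rightarrow> real mat \<Rightarrow> real mat \<Rightarrow> bool" where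
  "cholesky n B L \<longleftrightarrow>
     L \<in> carrier_mat n n \<and> upper_triangular L \<and> (\<forall>i<n. L $$ (i, i) > 0) \<and> B = L\<^sup>T * L"

text \<open>\<open>norm2\<close> is the Euclidean norm, \<open>wnorm B\<close> the weighted norm \<open>\<parallel>x\<parallel>\<^sub>B\<close>.\<close>

definition norm2 :: "real vec \<Rightarrow> real" where
  "norm2 x = sqrt (x \<bullet> x)"

definition wnorm :: "real mat \<Rightarrow> real vec \<Rightarrow> real" where
  "wnorm B x = sqrt (x \<bullet> (B *\<^sub>v x))"

text \<open>The library's \<open>orthogonal_mat\<close> only asks for nonzero, pairwise orthogonal columns;
  here the columns are orthonormal.\<close>

definition orthonormal_mat :: "nat \<Rightarrow> real mat \<Rightarrow> bool" where
  "orthonormal_mat n U \<longleftrightarrow> U \<in> carrier_mat n n \<and> U\<^sup>T * U = 1\<^sub>m n"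

text \<open>
  Rows and columns of \<open>mat\<close> and entries of \<open>vec\<close> and lists are indexed from 0. The families
  of scalars and vectors \<open>\<sigma>\<close>, \<open>u\<close>, \<open>v\<close>, \<open>\<alpha>\<close>, \<open>\<beta>\<close> are functions on \<open>nat\<close> that keep the indexing from 1
  (\<open>v 0 = 0\<close>), and only the listed indices matter.
\<close>

definition gsvd_Sigma :: "nat \<Rightarrow> nat \<Rightarrow> nat \<Rightarrow> (nat \<Rightarrow> real) \<Rightarrow> real mat" where
  "gsvd_Sigma m n r \<sigma> = mat m n (\<lambda>(i, j). if i = j \<and> i < r then \<sigma> (i + 1) else 0)"

text \<open>Normalized GSVD of \<open>{L\<^sub>M A, L\<^sub>N}\<close>, where \<open>C\<close> stands for \<open>L\<^sub>M A\<close>; the values \<open>\<sigma> 1, \<dots>, \<sigma> r\<close> are ordered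
  decreasingly.\<close>

definition normalized_gsvd ::
  "nat \<Rightarrow> nat \<Rightarrow> nat \<Rightarrow> real mat \<Rightarrow> real mat \<Rightarrow> real mat \<Rightarrow>
   real mat \<Rightarrow> real mat \<Rightarrow> (nat \<Rightarrow> real) \<Rightarrow> real mat \<Rightarrow> bool" where
  "normalized_gsvd m n r N C L\<^sub>N U\<^sub>A U\<^sub>L \<sigma> Z \<longleftrightarrow>
     orthonormal_mat m U\<^sub>A \<and> orthonormal_mat n U\<^sub>L \<and>
     Z \<in> carrier_mat n n \<and> invertible_mat Z \<and> Z\<^sup>T * minv N * Z = 1\<^sub>m n \<and>
     C = U\<^sub>A * gsvd_Sigma m n r \<sigma> * minv Z \<and>
     L\<^sub>N = U\<^sub>L * minv Z \<and>
     (\<forall>i\<in>{1..r}. \<sigma> i > 0) \<and> (\<forall>i\<in>{1..<r}. \<sigma> i \<ge> \<sigma> (i + 1))"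

definition wadjoint :: "real mat \<Rightarrow> real mat \<Rightarrow> real mat \<Rightarrow> real mat" where
  "wadjoint M N A = N * A\<^sup>T * minv M"

text \<open>\<open>gen_gkb m n A b M N l u v \<alpha> \<beta>\<close>: the first \<open>l\<close> vectors and coefficients of each family
  satisfy the recursions and the normalization of gen-GKB.\<close>

definition gen_gkb ::
  "nat \<Rightarrow> nat \<Rightarrow> real mat \<Rightarrow> real vec \<Rightarrow> real mat \<Rightarrow> real mat \<Rightarrow> nat \<Rightarrow>
   (nat \<Rightarrow> real vec) \<Rightarrow> (nat \<Rightarrow> real vec) \<Rightarrow> (nat \<Rightarrow> real) \<Rightarrow> (nat \<Rightarrow> real) \<Rightarrow> bool" where
  "gen_gkb m n A b M N l u v \<alpha> \<beta> \<longleftrightarrow>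
     v 0 = 0\<^sub>v n \<and>
     (\<forall>i\<in>{1..l}. u i \<in> carrier_vec m \<and> v i \<in> carrier_vec n \<and> \<alpha> i \<ge> 0 \<and> \<beta> i \<ge> 0 \<and>
        wnorm (minv M) (u i) = 1 \<and> wnorm (minv N) (v i) = 1) \<and>
     \<beta> 1 \<cdot>\<^sub>v u 1 = b \<and>
     (\<forall>i\<in>{1..l}. \<alpha> i \<cdot>\<^sub>v v i = wadjoint M N A *\<^sub>v u i - \<beta> i \<cdot>\<^sub>v v (i - 1)) \<and>
     (\<forall>i\<in>{1..<l}. \<beta> (i + 1) \<cdot>\<^sub>v u (i + 1) = A *\<^sub>v v i - \<alpha> i \<cdot>\<^sub>v u i)"

definition bidiag :: "nat \<Rightarrow> (nat \<Rightarrow> real) \<Rightarrow> (nat \<Rightarrow> real) \<Rightarrow> real mat" where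
  "bidiag k \<alpha> \<beta> = mat (k + 1) k
     (\<lambda>(i, j). if i = j then \<alpha> (j + 1) else if i = j + 1 then \<beta> (j + 2) else 0)"

definition spr_coeffs :: "nat \<Rightarrow> (nat \<Rightarrow> real) \<Rightarrow> (nat \<Rightarrow> real) \<Rightarrow> real vec" where
  "spr_coeffs k \<alpha> \<beta> =
     (ARG_MIN (\<lambda>y. norm2 (bidiag k \<alpha> \<beta> *\<^sub>v y - \<beta> 1 \<cdot>\<^sub>v unit_vec (k + 1) 0)) y. y \<in> carrier_vec k)"

definition genGKB_SPR ::
  "nat \<Rightarrow> nat \<Rightarrow> (nat \<Rightarrow> real vec) \<Rightarrow> (nat \<Rightarrow> real) \<Rightarrow> (nat \<Rightarrow> real) \<Rightarrow> real vec" where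
  "genGKB_SPR n k v \<alpha> \<beta> = mat_of_cols n (map v [1..<k + 1]) *\<^sub>v spr_coeffs k \<alpha> \<beta>"

text \<open>The \<open>min (dim_row B) (dim_col B)\<close> singular values in decreasing order, with multiplicity:
  the square roots of the largest eigenvalues of \<open>B\<^sup>T B\<close>, whose characteristic polynomial splits over
  the reals.\<close>

definition singular_values :: "real mat \<Rightarrow> real list" where
  "singular_values B = take (min (dim_row B) (dim_col B))
     (rev (sorted_list_of_multiset (image_mset sqrt (proots (char_poly (B\<^sup>T * B))))))"

end

theory Submission
  imports Defs
begin

text \<open>
  In the coordinates \<open>U\<^sub>A\<^sup>T L\<^sub>M u\<close> on the left and \<open>Z\<^sup>-\<^sup>1 v\<close> on the right, the matrix \<open>A\<close> and its weighted adjoint become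
  \<open>\<Sigma>\<^sub>A\<close> and \<open>\<Sigma>\<^sub>A\<^sup>T\<close> (\<open>gsvd_coordinates\<close>). Since \<open>\<Sigma>\<^sub>A\<close> is diagonal, the recursions of gen-GKB decouple into
  one pair of scalar recursions per coordinate. Elimination of the left vectors shows that the \<open>i\<close>-th right vector has
  coordinates \<open>P\<^sub>i(\<sigma>\<^sub>l\<^sup>2)\<close> times those of \<open>v\<^sub>1\<close> for \<open>l \<le> r\<close>, and zero beyond, where the \<open>P\<^sub>i\<close> are the Lanczos polynomials of
  \<open>B\<^sub>k\<^sup>T B\<^sub>k\<close>, given by a three-term recurrence (\<open>gkb_gsvd_coordinate\<close>). So, for \<open>l \<le> r\<close>, the \<open>l\<close>-th coordinate of \<open>x\<^sub>k\<close> is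
  \<open>Q(\<sigma>\<^sub>l\<^sup>2) \<sigma>\<^sub>l (u\<^bsub>A,l\<^esub>\<^sup>T L\<^sub>M b) / (\<alpha>\<^sub>1 \<beta>\<^sub>1)\<close> with \<open>Q = \<Sum>\<^sub>j y\<^sub>j P\<^sub>j\<close>, where \<open>y\<close> is the projected solution.

  The recurrence says that the vector \<open>(P\<^sub>1(t), \<dots>, P\<^sub>k(t))\<close> satisfies the eigenvector equation of
  \<open>B\<^sub>k\<^sup>T B\<^sub>k\<close> for \<open>t\<close> up to a multiple of \<open>P\<^bsub>k+1\<^esub>(t)\<close> in the last entry (\<open>gram_mult_gkb_poly_vec\<close>).
  This has two consequences. Paired with the normal equations for \<open>y\<close>, it yields
  \<open>t Q(t) = \<alpha>\<^sub>1 \<beta>\<^sub>1 (1 - P\<^bsub>k+1\<^esub>(t) / P\<^bsub>k+1\<^esub>(0))\<close> (\<open>projected_solution_polynomial\<close>). And the roots of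
  \<open>P\<^bsub>k+1\<^esub>\<close> are eigenvalues of \<open>B\<^sub>k\<^sup>T B\<^sub>k\<close>; by the Christoffel-Darboux identities there are \<open>k\<close> distinct
  real ones (\<open>card_real_roots_three_term\<close>), so they are all the squared singular values of \<open>B\<^sub>k\<close>. Therefore
  \<open>P\<^bsub>k+1\<^esub>(t) / P\<^bsub>k+1\<^esub>(0)\<close> is the product of the \<open>(\<theta>\<^sub>j\<^sup>2 - t) / \<theta>\<^sub>j\<^sup>2\<close>, and \<open>t = \<sigma>\<^sub>l\<^sup>2\<close> gives
  the filter factors.
\<close>

section \<open>Polynomials of a three-term recurrence\<close>

text \<open>The index is shifted by one against the degree, so that the first two values \<open>0\<close> and \<open>1\<close> are
  the coefficients of \<open>v\<^sub>0 = 0\<close> and \<open>v\<^sub>1\<close> in terms of \<open>v\<^sub>1\<close>, and the recurrence is uniform from the first step on.\<close>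

fun three_term_poly :: "(nat \<Rightarrow> 'a::field) \<Rightarrow> (nat \<Rightarrow> 'a) \<Rightarrow> nat \<Rightarrow> 'a poly" where
  "three_term_poly a b 0 = 0"
| "three_term_poly a b (Suc 0) = 1"
| "three_term_poly a b (Suc (Suc i)) =
     Polynomial.smult (1 / b (i + 2))
       ([:- a (i + 1), 1:] * three_term_poly a b (Suc i) - Polynomial.smult (b (i + 1)) (three_term_poly a b i))"

lemma three_term_poly_recurrence:
  assumes "1 \<le> i" and "b (i + 1) \<noteq> 0"
  shows "Polynomial.smult (b (i + 1)) (three_term_poly a b (i + 1)) =
    [:- a i, 1:] * three_term_poly a b i - Polynomial.smult (b i) (three_term_poly a b (i - 1))"
  using assms by (cases i) auto

lemma poly_three_term_recurrence:
  assumes "1 \<le> i" and "b (i + 1) \<noteq> 0"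
  shows "b (i + 1) * poly (three_term_poly a b (i + 1)) x =
    (x - a i) * poly (three_term_poly a b i) x - b i * poly (three_term_poly a b (i - 1)) x"
  using arg_cong[OF three_term_poly_recurrence[of i b a, OF assms], of "\<lambda>p. poly p x"]
  by (simp add: algebra_simps)

lemma degree_three_term_poly:
  assumes "\<forall>i\<in>{2..k + 1}. b i \<noteq> 0"
  shows "degree (three_term_poly a b (k + 1)) = k \<and> three_term_poly a b (k + 1) \<noteq> 0"
  using assms
proof (induction k rule: less_induct)
  case (less k)
  let ?P = "three_term_poly a b"
  show ?case
  proof (cases k)
    case (Suc i)
    have IH: "degree (?P (i + 1)) = i" "?P (i + 1) \<noteq> 0"
      using less Suc by auto
    have lower: "degree (?P i) < i + 1"
    proof (cases i)
      case (Suc h)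
      then show ?thesis using less.IH[of h] less.prems \<open>k = Suc i\<close> by auto
    qed simp
    have lead: "degree ([:- a (i + 1), 1:] * ?P (i + 1)) = i + 1"
      using IH by (subst degree_mult_eq) auto
    have "degree (- Polynomial.smult (b (i + 1)) (?P i)) < i + 1"
      using lower degree_smult_le[of "b (i + 1)" "?P i"] by (simp add: le_less_trans)
    then have "degree ([:- a (i + 1), 1:] * ?P (i + 1) + - Polynomial.smult (b (i + 1)) (?P i)) = i + 1"
      using lead degree_add_eq_left by metis
    moreover have "b (i + 2) \<noteq> 0" using less.prems Suc by auto
    ultimately show ?thesis using Suc by (auto simp del: mult_pCons_left)
  qed simp
qed

text \<open>One step of the recurrence turns the expression on the left for \<open>k + 1\<close> into the one for \<open>k\<close> plus
  \<open>(x - y) P\<^bsub>k+1\<^esub>(x) P\<^bsub>k+1\<^esub>(y)\<close>. For real coefficients and \<open>y\<close> the complex conjugate of \<open>x\<close>, the sum is a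
  positive real number, which leaves no room for a non-real root.\<close>

lemma christoffel_darboux:
  fixes a b :: "nat \<Rightarrow> 'a::field"
  assumes "\<forall>i\<in>{2..k + 1}. b i \<noteq> 0"
  defines "P \<equiv> three_term_poly a b"
  shows "k \<ge> 1 \<Longrightarrow> b (k + 1) * (poly (P (k + 1)) x * poly (P k) y - poly (P k) x * poly (P (k + 1)) y) =
    (x - y) * (\<Sum>i = 1..k. poly (P i) x * poly (P i) y)"
  using assms(1)
proof (induction k)
  case (Suc k)
  have rec: "b (k + 2) * poly (P (k + 2)) z =
      (z - a (k + 1)) * poly (P (k + 1)) z - b (k + 1) * poly (P k) z" for z
    using poly_three_term_recurrence[of "k + 1" b a z] Suc.prems by (simp add: P_def)
  have "b (k + 2) * (poly (P (k + 2)) x * poly (P (k + 1)) y - poly (P (k + 1)) x * poly (P (k + 2)) y) =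
    (b (k + 2) * poly (P (k + 2)) x) * poly (P (k + 1)) y
      - poly (P (k + 1)) x * (b (k + 2) * poly (P (k + 2)) y)"
    by (simp add: algebra_simps)
  also have "\<dots> = (x - y) * (poly (P (k + 1)) x * poly (P (k + 1)) y)
      + b (k + 1) * (poly (P (k + 1)) x * poly (P k) y - poly (P k) x * poly (P (k + 1)) y)"
    unfolding rec by (simp add: algebra_simps)
  also have "b (k + 1) * (poly (P (k + 1)) x * poly (P k) y - poly (P k) x * poly (P (k + 1)) y) =
      (x - y) * (\<Sum>i = 1..k. poly (P i) x * poly (P i) y)"
    using Suc by (cases "k = 0") (auto simp: P_def)
  finally show ?case by (simp add: algebra_simps)
qed simp

text \<open>The limit \<open>y \<longlonglongrightarrow> x\<close> of \<open>christoffel_darboux\<close>, obtained algebraically by the same telescoping.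
  For real coefficients, a common real root of \<open>P\<^bsub>k+1\<^esub>\<close> and its derivative would annihilate a sum of
  squares of real numbers that contains \<open>P\<^sub>1\<^sup>2 = 1\<close>; so real roots are simple.\<close>

lemma christoffel_darboux_confluent:
  fixes a b :: "nat \<Rightarrow> 'a::field"
  assumes "\<forall>i\<in>{2..k + 1}. b i \<noteq> 0"
  defines "P \<equiv> three_term_poly a b"
  shows "k \<ge> 1 \<Longrightarrow> b (k + 1) * (poly (pderiv (P (k + 1))) x * poly (P k) x
      - poly (pderiv (P k)) x * poly (P (k + 1)) x) = (\<Sum>i = 1..k. (poly (P i) x)\<^sup>2)"
  using assms(1)
proof (induction k)
  case (Suc k)
  have b: "b (k + 2) \<noteq> 0" using Suc.prems by auto
  have rec: "b (k + 2) * poly (P (k + 2)) x =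
      (x - a (k + 1)) * poly (P (k + 1)) x - b (k + 1) * poly (P k) x"
    using poly_three_term_recurrence[of "k + 1" b a x] b by (simp add: P_def)
  have drec: "b (k + 2) * poly (pderiv (P (k + 2))) x = poly (P (k + 1)) x
      + (x - a (k + 1)) * poly (pderiv (P (k + 1))) x - b (k + 1) * poly (pderiv (P k)) x"
    using arg_cong[OF three_term_poly_recurrence[of "k + 1" b a], of "\<lambda>p. poly (pderiv p) x"] b
    by (simp add: P_def pderiv_smult pderiv_diff pderiv_mult pderiv_pCons pderiv_add algebra_simps
        del: three_term_poly.simps)
  have "b (k + 2) * (poly (pderiv (P (k + 2))) x * poly (P (k + 1)) x
        - poly (pderiv (P (k + 1))) x * poly (P (k + 2)) x) =
      (b (k + 2) * poly (pderiv (P (k + 2))) x) * poly (P (k + 1)) x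
        - poly (pderiv (P (k + 1))) x * (b (k + 2) * poly (P (k + 2)) x)"
    by (simp add: algebra_simps)
  also have "\<dots> = (poly (P (k + 1)) x)\<^sup>2 + b (k + 1) * (poly (pderiv (P (k + 1))) x * poly (P k) x
      - poly (pderiv (P k)) x * poly (P (k + 1)) x)"
    unfolding rec drec by (simp add: algebra_simps power2_eq_square)
  also have "b (k + 1) * (poly (pderiv (P (k + 1))) x * poly (P k) x
      - poly (pderiv (P k)) x * poly (P (k + 1)) x) = (\<Sum>i = 1..k. (poly (P i) x)\<^sup>2)"
    using Suc by (cases "k = 0") (auto simp: P_def)
  finally show ?case by (simp add: algebra_simps)
qed simp

lemma of_real_poly_three_term:
  "poly (three_term_poly (\<lambda>i. of_real (a i)) (\<lambda>i. of_real (b i)) j) (of_real x :: 'a :: real_field) =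
    of_real (poly (three_term_poly a b j) x)"
  by (induction a b j rule: three_term_poly.induct) auto

lemma cnj_poly_three_term:
  "poly (three_term_poly (\<lambda>i. of_real (a i)) (\<lambda>i. of_real (b i)) j) (cnj z) =
    cnj (poly (three_term_poly (\<lambda>i. of_real (a i)) (\<lambda>i. of_real (b i)) j) z)"
  by (induction j rule: three_term_poly.induct[where ?a0.0 = "a" and ?a1.0 = b]) auto

lemma sum_squares_three_term_pos:
  fixes a b :: "nat \<Rightarrow> real"
  assumes "k \<ge> 1"
  shows "0 < (\<Sum>i = 1..k. (poly (three_term_poly a b i) x)\<^sup>2)"
proof (rule sum_pos2[of _ 1])
qed (use assms in auto)

text \<open>Over the complex numbers \<open>P\<^bsub>k+1\<^esub>\<close> has \<open>k\<close> roots with multiplicity. The two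
  Christoffel-Darboux identities show that they are real and simple, so there are \<open>k\<close> distinct real ones.\<close>

lemma card_real_roots_three_term:
  fixes a b :: "nat \<Rightarrow> real"
  assumes k: "k \<ge> 1" and b: "\<forall>i\<in>{2..k + 1}. b i \<noteq> 0"
  shows "card {x. poly (three_term_poly a b (k + 1)) x = 0} = k"
proof -
  let ?Q = "three_term_poly (\<lambda>i. complex_of_real (a i)) (\<lambda>i. complex_of_real (b i))"
  let ?P = "three_term_poly a b"
  have bc: "\<forall>i\<in>{2..k + 1}. complex_of_real (b i) \<noteq> 0" using b by simp
  have real_root: "z \<in> \<real>" if root: "poly (?Q (k + 1)) z = 0" for z
  proof -
    have "(\<Sum>i = 1..k. poly (?Q i) z * poly (?Q i) (cnj z)) =
        complex_of_real (\<Sum>i = 1..k. (cmod (poly (?Q i) z))\<^sup>2)"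
      by (simp only: cnj_poly_three_term complex_norm_square[symmetric] of_real_sum)
    moreover have "0 < (\<Sum>i = 1..k. (cmod (poly (?Q i) z))\<^sup>2)"
      by (rule sum_pos2[of _ 1]) (use k in auto)
    moreover have "(z - cnj z) * (\<Sum>i = 1..k. poly (?Q i) z * poly (?Q i) (cnj z)) = 0"
      using christoffel_darboux[OF bc k, where x = z and y = "cnj z"
          and a = "\<lambda>i. complex_of_real (a i)"] root
      by (simp add: cnj_poly_three_term)
    ultimately have "z - cnj z = 0" by (simp del: of_real_sum of_real_power)
    then show ?thesis by (simp add: Reals_cnj_iff)
  qed
  \<comment> \<open>No root is lost or identified when passing from the complex to the real polynomial.\<close>
  have roots: "{z. poly (?Q (k + 1)) z = 0} = complex_of_real ` {x. poly (?P (k + 1)) x = 0}"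
  proof -
    have iff: "poly (?Q (k + 1)) (complex_of_real x) = 0 \<longleftrightarrow> poly (?P (k + 1)) x = 0" for x
      by (simp only: of_real_poly_three_term of_real_eq_0_iff)
    have "{z. poly (?Q (k + 1)) z = 0} \<subseteq> range complex_of_real"
      using real_root by (auto simp only: Reals_def[symmetric])
    then show ?thesis using iff by blast
  qed
  have "rsquarefree (?Q (k + 1))"
    unfolding rsquarefree_roots
  proof (intro allI notI, elim conjE)
    fix z assume z: "poly (?Q (k + 1)) z = 0" "poly (pderiv (?Q (k + 1))) z = 0"
    then obtain x where x: "z = of_real x" using real_root by (auto elim: Reals_cases)
    have "(\<Sum>i = 1..k. (poly (?Q i) z)\<^sup>2) = 0"
      using christoffel_darboux_confluent[OF bc k, where x = z and a = "\<lambda>i. complex_of_real (a i)"] z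
      by simp
    then have "complex_of_real (\<Sum>i = 1..k. (poly (?P i) x)\<^sup>2) = 0"
      by (simp add: x of_real_poly_three_term)
    then show False using sum_squares_three_term_pos[OF k, of a b x]
      by (simp only: of_real_eq_0_iff)
  qed
  have nz: "?Q (k + 1) \<noteq> 0" and deg: "degree (?Q (k + 1)) = k"
    using degree_three_term_poly[OF bc] by auto
  have simple: "Polynomial.order z (?Q (k + 1)) = 1" if "poly (?Q (k + 1)) z = 0" for z
    using \<open>rsquarefree (?Q (k + 1))\<close> nz that by (metis order_root rsquarefree_def)
  have "k = size (proots (?Q (k + 1)))" using deg size_proots_complex by metis
  also have "\<dots> = (\<Sum>z\<in>{z. poly (?Q (k + 1)) z = 0}. Polynomial.order z (?Q (k + 1)))"
    unfolding size_multiset_overloaded_eq using nz by (simp del: three_term_poly.simps)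
  also have "\<dots> = (\<Sum>z\<in>{z. poly (?Q (k + 1)) z = 0}. 1)"
    using simple by (intro sum.cong) (simp_all del: three_term_poly.simps)
  also have "\<dots> = card {z. poly (?Q (k + 1)) z = 0}" by simp
  also have "\<dots> = card {x. poly (?P (k + 1)) x = 0}"
    unfolding roots by (rule card_image) (auto simp: inj_on_def)
  finally show ?thesis by simp
qed

text \<open>The linear factors of distinct roots are coprime, so their product divides \<open>p\<close>; the degrees agree, so
  the cofactor is constant.\<close>

lemma poly_eq_prod_roots:
  fixes p :: "'a::field poly"
  assumes "p \<noteq> 0" and "card {x. poly p x = 0} = degree p"
  shows "p = Polynomial.smult (lead_coeff p) (\<Prod>x\<in>{x. poly p x = 0}. [:- x, 1:])"
proof -
  let ?R = "{x. poly p x = 0}"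
  have fin: "finite ?R" using assms(1) poly_roots_finite by blast
  have "(\<Prod>x\<in>S. [:- x, 1:]) dvd p" if "finite S" "S \<subseteq> ?R" for S
    using that
  proof (induction S rule: finite_induct)
    case (insert x S)
    then obtain q where q: "p = (\<Prod>x\<in>S. [:- x, 1:]) * q" by (auto elim: dvdE)
    have "poly (\<Prod>x\<in>S. [:- x, 1:]) x \<noteq> 0" using insert by (auto simp: poly_prod)
    then have "poly q x = 0" using insert.prems q by (auto simp del: poly_prod)
    then have "[:- x, 1:] dvd q" by (simp add: poly_eq_0_iff_dvd)
    then show ?case using insert.hyps q by (metis mult.commute mult_dvd_mono dvd_refl prod.insert)
  qed simp
  from this[OF fin order_refl] obtain q where q: "p = (\<Prod>x\<in>?R. [:- x, 1:]) * q" by (elim dvdE)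
  have deg: "degree (\<Prod>x\<in>?R. [:- x, 1:]) = card ?R"
    by (subst degree_prod_eq_sum_degree) auto
  have lc: "lead_coeff (\<Prod>x\<in>?R. [:- x, 1:]) = 1"
    by (simp add: lead_coeff_prod)
  have "q \<noteq> 0" "(\<Prod>x\<in>?R. [:- x, 1:]) \<noteq> 0" using assms(1) q by auto
  then have "degree p = card ?R + degree q" using deg q by (metis degree_mult_eq)
  then have "degree q = 0" using assms(2) by simp
  then obtain c where c: "q = [:c:]" by (rule degree_eq_zeroE)
  then have "p = Polynomial.smult c (\<Prod>x\<in>?R. [:- x, 1:])" using q by simp
  moreover from this have "lead_coeff p = c" using lc by (metis lead_coeff_smult mult.right_neutral)
  ultimately show ?thesis by simp
qed

section \<open>The Gram matrix of a lower bidiagonal matrix\<close>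

definition gram_diag :: "(nat \<Rightarrow> real) \<Rightarrow> (nat \<Rightarrow> real) \<Rightarrow> nat \<Rightarrow> real" where
  "gram_diag \<alpha> \<beta> i = (\<alpha> i)\<^sup>2 + (\<beta> (i + 1))\<^sup>2"

definition gram_off :: "(nat \<Rightarrow> real) \<Rightarrow> (nat \<Rightarrow> real) \<Rightarrow> nat \<Rightarrow> real" where
  "gram_off \<alpha> \<beta> i = \<alpha> i * \<beta> i"

text \<open>These are the Lanczos polynomials of the Gram matrix \<open>B\<^sub>k\<^sup>T B\<^sub>k\<close>, a symmetric tridiagonal
  matrix with diagonal \<open>gram_diag\<close> and off-diagonal \<open>gram_off\<close>. If no off-diagonal entry vanishes, then, up to a constant factor,
  \<open>gkb_poly \<alpha> \<beta> (k + 1)\<close> is its characteristic polynomial.\<close>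

definition gkb_poly :: "(nat \<Rightarrow> real) \<Rightarrow> (nat \<Rightarrow> real) \<Rightarrow> nat \<Rightarrow> real poly" where
  "gkb_poly \<alpha> \<beta> = three_term_poly (gram_diag \<alpha> \<beta>) (gram_off \<alpha> \<beta>)"

definition gkb_poly_vec :: "nat \<Rightarrow> (nat \<Rightarrow> real) \<Rightarrow> (nat \<Rightarrow> real) \<Rightarrow> real \<Rightarrow> real vec" where
  "gkb_poly_vec k \<alpha> \<beta> t = vec k (\<lambda>j. poly (gkb_poly \<alpha> \<beta> (j + 1)) t)"

lemma scalar_prod_self_le_0:
  fixes x :: "real vec"
  assumes "x \<in> carrier_vec n" and "x \<bullet> x \<le> 0"
  shows "x = 0\<^sub>v n"
  using conjugate_square_greater_0_vec[OF assms(1)] assms by auto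

lemma gkb_poly_vec_carrier [simp]: "gkb_poly_vec k \<alpha> \<beta> t \<in> carrier_vec k"
  by (simp add: gkb_poly_vec_def)

lemma bidiag_carrier [simp]: "bidiag k \<alpha> \<beta> \<in> carrier_mat (k + 1) k"
  by (simp add: bidiag_def)

lemma bidiag_mult_vec_index:
  assumes x: "x \<in> carrier_vec k" and i: "i < k + 1"
  shows "(bidiag k \<alpha> \<beta> *\<^sub>v x) $ i =
    (if i < k then \<alpha> (i + 1) * x $ i else 0) + (if 0 < i then \<beta> (i + 1) * x $ (i - 1) else 0)"
proof -
  have "(bidiag k \<alpha> \<beta> *\<^sub>v x) $ i = (\<Sum>j = 0..<k. bidiag k \<alpha> \<beta> $$ (i, j) * x $ j)"
    using x i by (auto simp: scalar_prod_def bidiag_def intro!: sum.cong)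
  also have "\<dots> = (\<Sum>j = 0..<k. (if j = i then \<alpha> (i + 1) * x $ i else 0)
      + (if j = i - 1 then if 0 < i then \<beta> (i + 1) * x $ (i - 1) else 0 else 0))"
    using i by (intro sum.cong) (auto simp: bidiag_def)
  also have "\<dots> = (if i < k then \<alpha> (i + 1) * x $ i else 0)
      + (if 0 < i then \<beta> (i + 1) * x $ (i - 1) else 0)"
    using i by (subst sum.distrib) (auto simp: sum.delta)
  finally show ?thesis .
qed

lemma bidiag_transpose_mult_vec_index:
  assumes z: "z \<in> carrier_vec (k + 1)" and j: "j < k"
  shows "((bidiag k \<alpha> \<beta>)\<^sup>T *\<^sub>v z) $ j = \<alpha> (j + 1) * z $ j + \<beta> (j + 2) * z $ (j + 1)"
proof -
  have "((bidiag k \<alpha> \<beta>)\<^sup>T *\<^sub>v z) $ j = (\<Sum>i = 0..<k + 1. bidiag k \<alpha> \<beta> $$ (i, j) * z $ i)"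
    using z j by (auto simp: scalar_prod_def bidiag_def intro!: sum.cong)
  also have "\<dots> = (\<Sum>i = 0..<k + 1. (if i = j then \<alpha> (j + 1) * z $ j else 0)
      + (if i = j + 1 then \<beta> (j + 2) * z $ (j + 1) else 0))"
    using j by (intro sum.cong) (auto simp: bidiag_def)
  also have "\<dots> = \<alpha> (j + 1) * z $ j + \<beta> (j + 2) * z $ (j + 1)"
    using j by (subst sum.distrib) (auto simp: sum.delta)
  finally show ?thesis .
qed

text \<open>Forward substitution: the first \<open>k\<close> rows form a lower triangular matrix with diagonal
  \<open>\<alpha>\<^sub>1, \<dots>, \<alpha>\<^sub>k\<close>.\<close>

lemma bidiag_injective:
  assumes \<alpha>: "\<forall>i\<in>{1..k}. \<alpha> i \<noteq> 0" and x: "x \<in> carrier_vec k"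
    and zero: "bidiag k \<alpha> \<beta> *\<^sub>v x = 0\<^sub>v (k + 1)"
  shows "x = 0\<^sub>v k"
proof -
  have "x $ i = 0" if "i < k" for i
    using that
  proof (induction i)
    case 0
    then show ?case
      using bidiag_mult_vec_index[OF x, of 0 \<alpha> \<beta>] \<alpha> zero by auto
  next
    case (Suc i)
    then show ?case
      using bidiag_mult_vec_index[OF x, of "Suc i" \<alpha> \<beta>] \<alpha> zero by auto
  qed
  then show ?thesis using x by (intro eq_vecI) auto
qed

text \<open>Each row is one instance of the three-term recurrence. Only the last row lacks its upper neighbour,
  \<open>P\<^bsub>k+1\<^esub>(t)\<close>, hence the correction term. Everything about \<open>B\<^sub>k\<close> is read off from this
  identity: at the roots of \<open>P\<^bsub>k+1\<^esub>\<close> it gives eigenvectors, and at general \<open>t\<close> it expresses the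
  projected solution in terms of \<open>P\<^bsub>k+1\<^esub>\<close>.\<close>

lemma gram_mult_gkb_poly_vec:
  assumes nz: "\<forall>i\<in>{2..k + 1}. \<alpha> i \<noteq> 0 \<and> \<beta> i \<noteq> 0" and k: "k \<ge> 1"
  shows "(bidiag k \<alpha> \<beta>)\<^sup>T *\<^sub>v (bidiag k \<alpha> \<beta> *\<^sub>v gkb_poly_vec k \<alpha> \<beta> t) =
    t \<cdot>\<^sub>v gkb_poly_vec k \<alpha> \<beta> t -
    (\<alpha> (k + 1) * \<beta> (k + 1) * poly (gkb_poly \<alpha> \<beta> (k + 1)) t) \<cdot>\<^sub>v unit_vec k (k - 1)" (is "?l = ?r")
proof (rule eq_vecI)
  fix j assume "j < dim_vec ?r"
  then have j: "j < k" by simp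
  let ?p = "\<lambda>i. poly (gkb_poly \<alpha> \<beta> i) t" and ?x = "gkb_poly_vec k \<alpha> \<beta> t"
  have Bx: "(bidiag k \<alpha> \<beta> *\<^sub>v ?x) $ i =
      (if i < k then \<alpha> (i + 1) * ?p (i + 1) else 0) + \<beta> (i + 1) * ?p i" if "i < k + 1" for i
    using that by (subst bidiag_mult_vec_index[OF gkb_poly_vec_carrier])
      (auto simp: gkb_poly_vec_def gkb_poly_def)
  have "?l $ j = \<alpha> (j + 1) * (\<alpha> (j + 1) * ?p (j + 1) + \<beta> (j + 1) * ?p j)
      + \<beta> (j + 2) * ((if j + 1 < k then \<alpha> (j + 2) * ?p (j + 2) else 0) + \<beta> (j + 2) * ?p (j + 1))"
    using j by (subst bidiag_transpose_mult_vec_index)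
      (simp_all only: Bx mult_mat_vec_carrier[OF bidiag_carrier gkb_poly_vec_carrier], simp_all)
  moreover have "(\<alpha> (j + 2) * \<beta> (j + 2)) * ?p (j + 2) =
      (t - ((\<alpha> (j + 1))\<^sup>2 + (\<beta> (j + 2))\<^sup>2)) * ?p (j + 1) - (\<alpha> (j + 1) * \<beta> (j + 1)) * ?p j"
    using poly_three_term_recurrence[of "j + 1" "gram_off \<alpha> \<beta>" "gram_diag \<alpha> \<beta>" t] nz j
    by (simp add: gkb_poly_def gram_off_def gram_diag_def del: three_term_poly.simps)
  ultimately have "?l $ j = t * ?p (j + 1) -
      (if j + 1 < k then 0 else (\<alpha> (j + 2) * \<beta> (j + 2)) * ?p (j + 2))"
    by (auto simp: algebra_simps power2_eq_square)
  also have "\<dots> = ?r $ j"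
    using j k by (cases "j + 1 < k") (auto simp: gkb_poly_vec_def dest!: Suc_lessI)
  finally show "?l $ j = ?r $ j" .
qed (simp add: bidiag_def)

lemma gram_off_nonzero:
  assumes "\<forall>i\<in>{2..k + 1}. \<alpha> i \<noteq> 0 \<and> \<beta> i \<noteq> 0"
  shows "\<forall>i\<in>{2..k + 1}. gram_off \<alpha> \<beta> i \<noteq> 0"
  using assms by (simp add: gram_off_def)

lemma gram_mult_gkb_poly_vec_root:
  assumes "\<forall>i\<in>{2..k + 1}. \<alpha> i \<noteq> 0 \<and> \<beta> i \<noteq> 0" and "k \<ge> 1"
    and "poly (gkb_poly \<alpha> \<beta> (k + 1)) t = 0"
  shows "(bidiag k \<alpha> \<beta>)\<^sup>T *\<^sub>v (bidiag k \<alpha> \<beta> *\<^sub>v gkb_poly_vec k \<alpha> \<beta> t) = t \<cdot>\<^sub>v gkb_poly_vec k \<alpha> \<beta> t"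
  unfolding gram_mult_gkb_poly_vec[OF assms(1,2)] assms(3) by (intro eq_vecI) (auto simp: gkb_poly_vec_def)

text \<open>A root \<open>t\<close> is an eigenvalue of the Gram matrix, with an eigenvector \<open>x\<close> whose first entry is \<open>1\<close>;
  hence \<open>t (x \<bullet> x)\<close> is the squared norm of \<open>B\<^sub>k x \<noteq> 0\<close>.\<close>

lemma gkb_poly_root_pos:
  assumes nz: "\<forall>i\<in>{1..k + 1}. \<alpha> i \<noteq> 0 \<and> \<beta> i \<noteq> 0" and k: "k \<ge> 1"
    and root: "poly (gkb_poly \<alpha> \<beta> (k + 1)) t = 0"
  shows "t > 0"
proof -
  let ?B = "bidiag k \<alpha> \<beta>" and ?x = "gkb_poly_vec k \<alpha> \<beta> t"
  have carr: "?B *\<^sub>v ?x \<in> carrier_vec (k + 1)"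
    by (rule mult_mat_vec_carrier[OF bidiag_carrier gkb_poly_vec_carrier])
  have "?B\<^sup>T *\<^sub>v (?B *\<^sub>v ?x) = t \<cdot>\<^sub>v ?x"
    using nz k root by (intro gram_mult_gkb_poly_vec_root) auto
  then have "t * (?x \<bullet> ?x) = (?B\<^sup>T *\<^sub>v (?B *\<^sub>v ?x)) \<bullet> ?x" by simp
  also have "\<dots> = (?B *\<^sub>v ?x) \<bullet> (?B *\<^sub>v ?x)"
    by (rule transpose_vec_mult_scalar[OF bidiag_carrier gkb_poly_vec_carrier carr])
  also have "\<dots> > 0"
  proof -
    have "?x $ 0 = 1" using k by (simp add: gkb_poly_vec_def gkb_poly_def)
    then have "?x \<noteq> 0\<^sub>v k" using k by auto
    then have "?B *\<^sub>v ?x \<noteq> 0\<^sub>v (k + 1)" using bidiag_injective[of k \<alpha> ?x \<beta>] nz by auto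
    then show ?thesis using scalar_prod_self_le_0[OF carr] by fastforce
  qed
  finally have "0 < t * (?x \<bullet> ?x)" .
  moreover have "0 \<le> ?x \<bullet> ?x" by (simp add: scalar_prod_def sum_nonneg)
  ultimately show ?thesis by (simp add: zero_less_mult_iff)
qed

text \<open>The \<open>k\<close> distinct roots are eigenvalues, and a polynomial of degree \<open>k\<close> has no others; so each
  eigenvalue of the Gram matrix is simple.\<close>

lemma proots_char_poly_gram:
  assumes nz: "\<forall>i\<in>{1..k + 1}. \<alpha> i \<noteq> 0 \<and> \<beta> i \<noteq> 0" and k: "k \<ge> 1"
  shows "proots (char_poly ((bidiag k \<alpha> \<beta>)\<^sup>T * bidiag k \<alpha> \<beta>)) =
    mset_set {t. poly (gkb_poly \<alpha> \<beta> (k + 1)) t = 0}" (is "proots ?c = mset_set ?R")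
proof -
  let ?B = "bidiag k \<alpha> \<beta>" and ?x = "gkb_poly_vec k \<alpha> \<beta>"
  have T: "?B\<^sup>T * ?B \<in> carrier_mat k k"
    by (rule mult_carrier_mat[of _ k "k + 1"]) (simp_all only: transpose_carrier_mat bidiag_carrier)
  have "card ?R = k"
    unfolding gkb_poly_def using card_real_roots_three_term[OF k gram_off_nonzero] nz by simp
  then have fin: "finite ?R" using k card.infinite by fastforce
  have deg: "degree ?c = k" and c0: "?c \<noteq> 0"
    using degree_monic_char_poly[OF T] by auto
  have "poly ?c t = 0" if t: "t \<in> ?R" for t
  proof -
    have "(?B\<^sup>T * ?B) *\<^sub>v ?x t = ?B\<^sup>T *\<^sub>v (?B *\<^sub>v ?x t)"
      by (rule assoc_mult_mat_vec[of _ k "k + 1" _ k]) (auto simp: bidiag_def)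
    also have "\<dots> = t \<cdot>\<^sub>v ?x t"
      using nz k t by (intro gram_mult_gkb_poly_vec_root) auto
    finally have "(?B\<^sup>T * ?B) *\<^sub>v ?x t = t \<cdot>\<^sub>v ?x t" .
    moreover have "?x t $ 0 = 1" using k by (simp add: gkb_poly_vec_def gkb_poly_def)
    then have "?x t \<noteq> 0\<^sub>v k" using k by auto
    ultimately have "eigenvector (?B\<^sup>T * ?B) (?x t) t"
      using T by (auto simp: eigenvector_def bidiag_def)
    then show ?thesis using eigenvalue_root_char_poly[OF T] by (auto simp: eigenvalue_def)
  qed
  then have sub: "mset_set ?R \<subseteq># proots ?c"
    using fin c0 by (intro mset_subset_eqI)
      (auto simp: count_mset_set' order_root Suc_le_eq)
  moreover have "size (proots ?c) \<le> size (mset_set ?R)"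
    using size_proots_le[of ?c] deg \<open>card ?R = k\<close> by simp
  ultimately show ?thesis
    by (metis leD subset_mset.le_imp_less_or_eq mset_subset_size)
qed

section \<open>Least squares and the projected solution\<close>

lemma norm2_le_iff: "norm2 x \<le> norm2 y \<longleftrightarrow> x \<bullet> x \<le> y \<bullet> y"
  by (simp add: norm2_def)

lemma normal_equations_solvable:
  fixes B :: "real mat"
  assumes B: "B \<in> carrier_mat l k" and c: "c \<in> carrier_vec k"
    and inj: "\<And>x. x \<in> carrier_vec k \<Longrightarrow> B *\<^sub>v x = 0\<^sub>v l \<Longrightarrow> x = 0\<^sub>v k"
  obtains y where "y \<in> carrier_vec k" "B\<^sup>T *\<^sub>v (B *\<^sub>v y) = c"
proof -
  have T: "B\<^sup>T * B \<in> carrier_mat k k" and BT: "B\<^sup>T \<in> carrier_mat k l" using B by auto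
  have "det (B\<^sup>T * B) \<noteq> 0"
  proof
    assume "det (B\<^sup>T * B) = 0"
    then obtain x where x: "x \<in> carrier_vec k" "x \<noteq> 0\<^sub>v k" and "(B\<^sup>T * B) *\<^sub>v x = 0\<^sub>v k"
      using det_0_iff_vec_prod_zero_field[OF T] by auto
    then have "B\<^sup>T *\<^sub>v (B *\<^sub>v x) = 0\<^sub>v k" using assoc_mult_mat_vec[OF BT B] by simp
    then have "(B *\<^sub>v x) \<bullet> (B *\<^sub>v x) = 0"
      using transpose_vec_mult_scalar[OF B x(1) mult_mat_vec_carrier[OF B x(1)]] x by simp
    then have "B *\<^sub>v x = 0\<^sub>v l"
      using scalar_prod_self_le_0[OF mult_mat_vec_carrier[OF B x(1)]] by simp
    then show False using inj x by blast
  qed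
  from det_non_zero_imp_unit[OF T this, of "()"]
  obtain C where C: "C \<in> carrier_mat k k" "(B\<^sup>T * B) * C = 1\<^sub>m k"
    by (auto simp: Units_def ring_mat_def)
  have "B\<^sup>T *\<^sub>v (B *\<^sub>v (C *\<^sub>v c)) = c"
    using assoc_mult_mat_vec[OF BT B, of "C *\<^sub>v c"] assoc_mult_mat_vec[OF T C(1) c] C c by simp
  then show ?thesis using that[of "C *\<^sub>v c"] C c by auto
qed

text \<open>A solution \<open>y\<^sub>0\<close> of the normal equations exists since \<open>B\<close> is injective. Its residual is orthogonal to the
  range of \<open>B\<close>, so by Pythagoras the squared residual norm at \<open>z\<close> exceeds the one at \<open>y\<^sub>0\<close> by
  the squared norm of \<open>B (z - y\<^sub>0)\<close>. Thus \<open>y\<^sub>0\<close> is the only minimizer, and it is the one that is selected.\<close>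

lemma least_squares_normal_equations:
  fixes B :: "real mat"
  assumes B: "B \<in> carrier_mat l k" and c: "c \<in> carrier_vec l"
    and inj: "\<And>x. x \<in> carrier_vec k \<Longrightarrow> B *\<^sub>v x = 0\<^sub>v l \<Longrightarrow> x = 0\<^sub>v k"
  defines "y \<equiv> (ARG_MIN (\<lambda>y. norm2 (B *\<^sub>v y - c)) y. y \<in> carrier_vec k)"
  shows "y \<in> carrier_vec k" and "B\<^sup>T *\<^sub>v (B *\<^sub>v y) = B\<^sup>T *\<^sub>v c"
proof -
  let ?obj = "\<lambda>y. (B *\<^sub>v y - c) \<bullet> (B *\<^sub>v y - c)"
  have BTc: "B\<^sup>T *\<^sub>v c \<in> carrier_vec k" using B c by auto
  obtain y0 where y0: "y0 \<in> carrier_vec k" and ne: "B\<^sup>T *\<^sub>v (B *\<^sub>v y0) = B\<^sup>T *\<^sub>v c"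
    using normal_equations_solvable[OF B BTc inj] by blast
  define e where "e = B *\<^sub>v y0 - c"
  have e: "e \<in> carrier_vec l" using B y0 c by (auto simp: e_def)
  have BTe: "B\<^sup>T *\<^sub>v e = 0\<^sub>v k"
    unfolding e_def using B c y0 ne BTc by (subst mult_minus_distrib_mat_vec[of _ k l]) auto
  have pyth: "?obj z = ?obj y0 + (B *\<^sub>v (z - y0)) \<bullet> (B *\<^sub>v (z - y0))"
    if z: "z \<in> carrier_vec k" for z
  proof -
    let ?d = "B *\<^sub>v (z - y0)"
    have d: "?d \<in> carrier_vec l" and zy: "z - y0 \<in> carrier_vec k" using B z y0 by auto
    have "?d = B *\<^sub>v z - B *\<^sub>v y0" using B z y0 by (rule mult_minus_distrib_mat_vec)
    then have split: "B *\<^sub>v z - c = e + ?d"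
      unfolding e_def using B z y0 c by (intro eq_vecI) auto
    have ed: "e \<bullet> ?d = 0"
      using transpose_vec_mult_scalar[OF B zy e] BTe zy by simp
    have "(e + ?d) \<bullet> (e + ?d) = e \<bullet> e + ?d \<bullet> ?d"
      using e d ed comm_scalar_prod[OF e d]
      by (simp add: add_scalar_prod_distrib[of _ l] scalar_prod_add_distrib[of _ l])
    then show ?thesis by (simp add: split e_def)
  qed
  have nonneg: "0 \<le> x \<bullet> x" for x :: "real vec" by (simp add: scalar_prod_def sum_nonneg)
  have "?obj y0 \<le> ?obj z" if "z \<in> carrier_vec k" for z
    using pyth[OF that] nonneg[of "B *\<^sub>v (z - y0)"] by linarith
  then have "is_arg_min (\<lambda>y. norm2 (B *\<^sub>v y - c)) (\<lambda>y. y \<in> carrier_vec k) y0"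
    using y0 by (simp add: is_arg_min_linorder norm2_le_iff)
  then have "is_arg_min (\<lambda>y. norm2 (B *\<^sub>v y - c)) (\<lambda>y. y \<in> carrier_vec k) y"
    unfolding y_def arg_min_def by (rule someI)
  then have y: "y \<in> carrier_vec k" and "?obj y \<le> ?obj y0"
    using y0 by (auto simp: is_arg_min_linorder norm2_le_iff)
  then have "(B *\<^sub>v (y - y0)) \<bullet> (B *\<^sub>v (y - y0)) \<le> 0" using pyth[OF y] by simp
  then have "B *\<^sub>v (y - y0) = 0\<^sub>v l"
    using B y y0 by (intro scalar_prod_self_le_0) auto
  then have "y - y0 = 0\<^sub>v k" using y y0 by (intro inj) auto
  moreover have "y = y0 + (y - y0)" using y y0 by (intro eq_vecI) auto
  ultimately have "y = y0" using y0 by simp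
  then show "y \<in> carrier_vec k" "B\<^sup>T *\<^sub>v (B *\<^sub>v y) = B\<^sup>T *\<^sub>v c" using y0 ne by auto
qed

lemma bidiag_transpose_unit_vec:
  assumes "k \<ge> 1"
  shows "(bidiag k \<alpha> \<beta>)\<^sup>T *\<^sub>v (\<beta> 1 \<cdot>\<^sub>v unit_vec (k + 1) 0) = (\<alpha> 1 * \<beta> 1) \<cdot>\<^sub>v unit_vec k 0" (is "?l = ?r")
proof (rule eq_vecI)
  fix j assume "j < dim_vec ?r"
  then show "?l $ j = ?r $ j" by (subst bidiag_transpose_mult_vec_index) auto
qed (simp add: bidiag_def)

text \<open>Let \<open>x(t)\<close> be the vector with entries \<open>P\<^sub>1(t), \<dots>, P\<^sub>k(t)\<close>, so that the sum is \<open>x(t) \<bullet> y\<close>.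
  Evaluate \<open>B\<^sub>k x(t) \<bullet> B\<^sub>k y\<close> in two ways. The normal equations
  \<open>B\<^sub>k\<^sup>T B\<^sub>k y = \<alpha>\<^sub>1 \<beta>\<^sub>1 e\<^sub>1\<close> give \<open>\<alpha>\<^sub>1 \<beta>\<^sub>1\<close>, as \<open>P\<^sub>1 = 1\<close>;
  moving \<open>B\<^sub>k\<^sup>T B\<^sub>k\<close> to \<open>x(t)\<close> gives \<open>t (x(t) \<bullet> y) - c P\<^bsub>k+1\<^esub>(t)\<close> with \<open>c\<close> independent of
  \<open>t\<close>. The value at \<open>t = 0\<close> determines \<open>c\<close>.\<close>

lemma projected_solution_polynomial:
  fixes y :: "real vec" and P :: "nat \<Rightarrow> real poly"
  assumes nz: "\<forall>i\<in>{1..k + 1}. \<alpha> i \<noteq> 0 \<and> \<beta> i \<noteq> 0" and k: "k \<ge> 1"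
  defines "y \<equiv> spr_coeffs k \<alpha> \<beta>" and "P \<equiv> gkb_poly \<alpha> \<beta>"
  shows "t * (\<Sum>j<k. poly (P (j + 1)) t * y $ j) =
    \<alpha> 1 * \<beta> 1 * (1 - poly (P (k + 1)) t / poly (P (k + 1)) 0)"
proof -
  let ?B = "bidiag k \<alpha> \<beta>" and ?x = "gkb_poly_vec k \<alpha> \<beta>"
  let ?s = "\<lambda>t. \<Sum>j<k. poly (P (j + 1)) t * y $ j"
  let ?c = "\<alpha> (k + 1) * \<beta> (k + 1) * y $ (k - 1)"
  have rhs: "\<beta> 1 \<cdot>\<^sub>v unit_vec (k + 1) 0 \<in> carrier_vec (k + 1)" by simp
  have inj: "x = 0\<^sub>v k" if "x \<in> carrier_vec k" "?B *\<^sub>v x = 0\<^sub>v (k + 1)" for x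
    using bidiag_injective[of k \<alpha> x \<beta>] nz that by auto
  have y: "y \<in> carrier_vec k" and "?B\<^sup>T *\<^sub>v (?B *\<^sub>v y) = (\<alpha> 1 * \<beta> 1) \<cdot>\<^sub>v unit_vec k 0"
    using least_squares_normal_equations[OF bidiag_carrier rhs inj] bidiag_transpose_unit_vec[OF k]
    unfolding y_def spr_coeffs_def by auto
  have xy: "?x t \<bullet> y = ?s t" for t
    using y by (auto simp: scalar_prod_def gkb_poly_vec_def P_def atLeast0LessThan intro!: sum.cong)
  have eq: "t * ?s t - ?c * poly (P (k + 1)) t = \<alpha> 1 * \<beta> 1" for t
  proof -
    note Bx = mult_mat_vec_carrier[OF bidiag_carrier gkb_poly_vec_carrier, of k \<alpha> \<beta> \<alpha> \<beta> t]
    note By = mult_mat_vec_carrier[OF bidiag_carrier y, of \<alpha> \<beta>]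
    have "(?B\<^sup>T *\<^sub>v (?B *\<^sub>v ?x t)) \<bullet> y = (?B *\<^sub>v ?x t) \<bullet> (?B *\<^sub>v y)"
      by (rule transpose_vec_mult_scalar[OF bidiag_carrier y Bx])
    also have "\<dots> = (?B *\<^sub>v y) \<bullet> (?B *\<^sub>v ?x t)" by (rule comm_scalar_prod[OF Bx By])
    also have "\<dots> = (?B\<^sup>T *\<^sub>v (?B *\<^sub>v y)) \<bullet> ?x t"
      by (rule transpose_vec_mult_scalar[OF bidiag_carrier gkb_poly_vec_carrier By, symmetric])
    also have "\<dots> = \<alpha> 1 * \<beta> 1"
      using k by (simp add: \<open>?B\<^sup>T *\<^sub>v (?B *\<^sub>v y) = _\<close> gkb_poly_vec_def gkb_poly_def)
    finally have "(?B\<^sup>T *\<^sub>v (?B *\<^sub>v ?x t)) \<bullet> y = \<alpha> 1 * \<beta> 1" .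
    moreover have "(?B\<^sup>T *\<^sub>v (?B *\<^sub>v ?x t)) \<bullet> y = t * (?x t \<bullet> y) - ?c * poly (P (k + 1)) t"
      using gram_mult_gkb_poly_vec[of k \<alpha> \<beta> t] nz k y
      by (simp add: minus_scalar_prod_distrib[of _ k] P_def)
    ultimately show ?thesis by (simp add: xy)
  qed
  have P0: "poly (P (k + 1)) 0 \<noteq> 0"
    using gkb_poly_root_pos[OF nz k, of 0] by (auto simp: P_def)
  have "?c = - (\<alpha> 1 * \<beta> 1) / poly (P (k + 1)) 0" using eq[of 0] P0 by (simp add: field_simps)
  then show ?thesis using eq[of t] P0 by (simp add: field_simps)
qed

section \<open>Singular values and filter factors\<close>

text \<open>\<open>P\<close> splits into \<open>k\<close> distinct linear factors, and its leading coefficient cancels in the quotient. The right-hand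
  side is the product in the filter factors, since the roots are the squared singular values.\<close>

lemma gkb_poly_ratio:
  assumes nz: "\<forall>i\<in>{1..k + 1}. \<alpha> i \<noteq> 0 \<and> \<beta> i \<noteq> 0" and k: "k \<ge> 1"
  defines "P \<equiv> gkb_poly \<alpha> \<beta> (k + 1)"
  shows "poly P t / poly P 0 = (\<Prod>x\<in>{x. poly P x = 0}. (x - t) / x)"
proof -
  have b: "\<forall>i\<in>{2..k + 1}. gram_off \<alpha> \<beta> i \<noteq> 0" using nz by (intro gram_off_nonzero) auto
  have "card {x. poly P x = 0} = degree P" "P \<noteq> 0"
    unfolding P_def gkb_poly_def
    using card_real_roots_three_term[OF k b] degree_three_term_poly[OF b] by simp_all
  then have P: "P = Polynomial.smult (lead_coeff P) (\<Prod>x\<in>{x. poly P x = 0}. [:- x, 1:])"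
    and lc: "lead_coeff P \<noteq> 0"
    using poly_eq_prod_roots by auto
  have eval: "poly P s = lead_coeff P * (\<Prod>x\<in>{x. poly P x = 0}. s - x)" for s
    by (subst P) (simp add: poly_prod)
  have "poly P t / poly P 0 = (\<Prod>x\<in>{x. poly P x = 0}. (t - x) / (0 - x))"
    by (simp only: eval[of t] eval[of 0] prod_dividef mult_divide_mult_cancel_left[OF lc])
  also have "\<dots> = (\<Prod>x\<in>{x. poly P x = 0}. (x - t) / x)"
    by (intro prod.cong refl) (metis minus_diff_eq diff_0 minus_divide_divide)
  finally show ?thesis .
qed

text \<open>The square root maps the \<open>k\<close> positive roots injectively to the singular values, so these are distinct, and sorting makes
  them strictly decreasing.\<close>

lemma singular_values_bidiag:
  assumes nz: "\<forall>i\<in>{1..k + 1}. \<alpha> i \<noteq> 0 \<and> \<beta> i \<noteq> 0" and k: "k \<ge> 1"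
  defines "\<theta>s \<equiv> singular_values (bidiag k \<alpha> \<beta>)"
  shows "length \<theta>s = k" and "sorted_wrt (>) \<theta>s" and "\<forall>x\<in>set \<theta>s. x > 0"
    and "bij_betw (\<lambda>x. x\<^sup>2) (set \<theta>s) {t. poly (gkb_poly \<alpha> \<beta> (k + 1)) t = 0}"
proof -
  let ?R = "{t. poly (gkb_poly \<alpha> \<beta> (k + 1)) t = 0}"
  have card: "card ?R = k"
    unfolding gkb_poly_def using card_real_roots_three_term[OF k gram_off_nonzero] nz by simp
  then have fin: "finite ?R" using k card.infinite by fastforce
  have pos: "\<forall>t\<in>?R. t > 0" using gkb_poly_root_pos[OF nz k] by auto
  have inj: "inj_on sqrt ?R" by (auto simp: inj_on_def)
  have "\<theta>s = take k (rev (sorted_list_of_set (sqrt ` ?R)))"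
    unfolding \<theta>s_def singular_values_def proots_char_poly_gram[OF nz k]
    using inj by (simp add: image_mset_mset_set bidiag_def)
  moreover have cardS: "card (sqrt ` ?R) = k" using card inj by (simp add: card_image)
  ultimately have \<theta>s: "\<theta>s = rev (sorted_list_of_set (sqrt ` ?R))" by simp
  show "length \<theta>s = k" using \<theta>s cardS by simp
  show "sorted_wrt (>) \<theta>s"
    using \<theta>s strict_sorted_list_of_set[of "sqrt ` ?R"] by (simp add: sorted_wrt_rev)
  have set: "set \<theta>s = sqrt ` ?R" using \<theta>s fin by simp
  show "\<forall>x\<in>set \<theta>s. x > 0" using set pos by auto
  have "bij_betw sqrt ?R (set \<theta>s)" using set inj by (simp add: bij_betw_def)
  moreover have "bij_betw (\<lambda>x. x\<^sup>2) (sqrt ` ?R) ?R"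
    using pos by (intro bij_betw_byWitness[of _ sqrt]) (auto intro: less_imp_le)
  ultimately show "bij_betw (\<lambda>x. x\<^sup>2) (set \<theta>s) ?R" using set by simp
qed

section \<open>Inverses and rank\<close>

lemma minv_inverse:
  assumes A: "A \<in> carrier_mat n n" and det: "det A \<noteq> 0"
  shows "minv A \<in> carrier_mat n n" and "A * minv A = 1\<^sub>m n" and "minv A * A = 1\<^sub>m n"
proof -
  obtain B where "mat_inverse A = Some B"
    using mat_inverse(1)[OF A, of "()"] det_non_zero_imp_unit[OF A det, of "()"]
    by (cases "mat_inverse A") auto
  then show "minv A \<in> carrier_mat n n" "A * minv A = 1\<^sub>m n" "minv A * A = 1\<^sub>m n"
    using mat_inverse(2)[OF A] by (auto simp: minv_def)
qed

lemma sym_pos_def_det_nonzero: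
  assumes "sym_pos_def n A"
  shows "det A \<noteq> 0"
proof
  have A: "A \<in> carrier_mat n n" using assms by (simp add: sym_pos_def_def)
  assume "det A = 0"
  then obtain x where x: "x \<in> carrier_vec n" "x \<noteq> 0\<^sub>v n" "A *\<^sub>v x = 0\<^sub>v n"
    using det_0_iff_vec_prod_zero_field[OF A] by auto
  moreover have "x \<bullet> (A *\<^sub>v x) > 0" using assms x(1,2) unfolding sym_pos_def_def by blast
  ultimately show False by simp
qed

lemma left_inverse_imp_det_nonzero:
  fixes A B :: "'a::field mat"
  assumes "A \<in> carrier_mat n n" and "B \<in> carrier_mat n n" and "B * A = 1\<^sub>m n"
  shows "det A \<noteq> 0"
  using det_mult[OF assms(2,1)] assms(3) by auto

text \<open>A maximal independent set of columns lives in a space of dimension \<open>n\<close>.\<close>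

lemma (in vec_space) rank_le_nr:
  assumes "A \<in> carrier_mat n nc"
  shows "rank A \<le> n"
proof -
  have sub: "set (cols A) \<subseteq> carrier_vec n" using cols_dim assms by blast
  obtain S where S: "maximal S (\<lambda>T. T \<subseteq> set (cols A) \<and> lin_indpt T)"
    using maximal_exists_superset[of "set (cols A)" "\<lambda>T. T \<subseteq> set (cols A) \<and> lin_indpt T" "{}"]
    by (auto simp: finite_lin_indpt2)
  then have "lin_indpt S" "S \<subseteq> carrier_vec n" using sub by (auto simp: maximal_def)
  then have "card S \<le> dim" using li_le_dim(2)[OF fin_dim] by simp
  then show ?thesis using rank_card_indpt[OF assms S] dim_is_n by simp
qed

section \<open>Generalized Golub-Kahan bidiagonalization in singular coordinates\<close>

lemma gsvd_Sigma_mult_vec_index: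
  assumes "x \<in> carrier_vec n" and "l < r" and "r \<le> n" and "r \<le> m"
  shows "(gsvd_Sigma m n r \<sigma> *\<^sub>v x) $ l = \<sigma> (l + 1) * x $ l"
proof -
  have "(gsvd_Sigma m n r \<sigma> *\<^sub>v x) $ l = (\<Sum>j = 0..<n. gsvd_Sigma m n r \<sigma> $$ (l, j) * x $ j)"
    using assms by (auto simp: gsvd_Sigma_def scalar_prod_def)
  also have "\<dots> = (\<Sum>j = 0..<n. if j = l then \<sigma> (l + 1) * x $ l else 0)"
    using assms by (intro sum.cong) (auto simp: gsvd_Sigma_def)
  finally have "(gsvd_Sigma m n r \<sigma> *\<^sub>v x) $ l = (\<Sum>j = 0..<n. if j = l then \<sigma> (l + 1) * x $ l else 0)" .
  then show ?thesis using assms by simp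
qed

lemma gsvd_Sigma_transpose_mult_vec_index:
  assumes "x \<in> carrier_vec m" and "l < n" and "r \<le> m"
  shows "((gsvd_Sigma m n r \<sigma>)\<^sup>T *\<^sub>v x) $ l = (if l < r then \<sigma> (l + 1) * x $ l else 0)"
proof -
  have "((gsvd_Sigma m n r \<sigma>)\<^sup>T *\<^sub>v x) $ l =
(\<Sum>j = 0..<m. gsvd_Sigma m n r \<sigma> $$ (j, l) * x $ j)"
    using assms by (auto simp: gsvd_Sigma_def scalar_prod_def)
  also have "\<dots> = (\<Sum>j = 0..<m. if j = l then if l < r then \<sigma> (l + 1) * x $ l else 0 else 0)"
    using assms by (intro sum.cong) (auto simp: gsvd_Sigma_def)
  finally have "((gsvd_Sigma m n r \<sigma>)\<^sup>T *\<^sub>v x) $ l =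
      (\<Sum>j = 0..<m. if j = l then if l < r then \<sigma> (l + 1) * x $ l else 0 else 0)" .
  then show ?thesis using assms by simp
qed

text \<open>\<open>Z\<^sup>T N\<^sup>-\<^sup>1\<close> is a left inverse of the square matrix \<open>Z\<close>, hence equal to \<open>Z\<^sup>-\<^sup>1\<close>. The last equation
  makes the weighted adjoint into an ordinary transpose in the coordinates \<open>Z\<^sup>-\<^sup>1 v\<close>.\<close>

lemma weighted_inverse_gsvd:
  assumes N: "sym_pos_def n N" and Z: "Z \<in> carrier_mat n n"
    and ortho: "Z\<^sup>T * minv N * Z = 1\<^sub>m n"
  shows "minv Z \<in> carrier_mat n n" and "Z * minv Z = 1\<^sub>m n" and "minv Z * Z = 1\<^sub>m n"
    and "minv Z * N = Z\<^sup>T"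
proof -
  have Nc: "N \<in> carrier_mat n n" using N by (simp add: sym_pos_def_def)
  note Ni = minv_inverse[OF Nc sym_pos_def_det_nonzero[OF N]]
  have ZN: "Z\<^sup>T * minv N \<in> carrier_mat n n" using Z Ni(1) by auto
  note Zi = minv_inverse[OF Z left_inverse_imp_det_nonzero[OF Z ZN ortho]]
  show "minv Z \<in> carrier_mat n n" "Z * minv Z = 1\<^sub>m n" "minv Z * Z = 1\<^sub>m n" by (rule Zi)+
  have "minv Z = (Z\<^sup>T * minv N * Z) * minv Z" unfolding ortho using Zi by simp
  also have "\<dots> = (Z\<^sup>T * minv N) * (Z * minv Z)" by (rule assoc_mult_mat[OF ZN Z Zi(1)])
  also have "\<dots> = Z\<^sup>T * minv N" unfolding Zi(2) by (rule right_mult_one_mat[OF ZN])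
  finally have "minv Z * N = Z\<^sup>T * minv N * N" by simp
  also have "\<dots> = Z\<^sup>T * (minv N * N)" using Z Ni(1) Nc by (intro assoc_mult_mat) auto
  finally show "minv Z * N = Z\<^sup>T" using Ni(3) Z by simp
qed

text \<open>In the coordinates \<open>U\<^sub>A\<^sup>T L\<^sub>M u\<close> and \<open>Z\<^sup>-\<^sup>1 v\<close>, the matrix \<open>A\<close> becomes \<open>\<Sigma>\<^sub>A\<close> and the weighted adjoint
  \<open>A\<^sup>*\<close> becomes \<open>\<Sigma>\<^sub>A\<^sup>T\<close>, so gen-GKB becomes the ordinary bidiagonalization of a diagonal matrix.\<close>

lemma gsvd_coordinates:
  fixes A M N L\<^sub>M L\<^sub>N U\<^sub>A U\<^sub>L Z :: "real mat"
  assumes A: "A \<in> carrier_mat m n" and N: "sym_pos_def n N"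
    and L\<^sub>M: "cholesky m (minv M) L\<^sub>M"
    and gsvd: "normalized_gsvd m n r N (L\<^sub>M * A) L\<^sub>N U\<^sub>A U\<^sub>L \<sigma> Z"
  shows "x \<in> carrier_vec n \<Longrightarrow>
      U\<^sub>A\<^sup>T *\<^sub>v (L\<^sub>M *\<^sub>v (A *\<^sub>v x)) = gsvd_Sigma m n r \<sigma> *\<^sub>v (minv Z *\<^sub>v x)"
    and "w \<in> carrier_vec m \<Longrightarrow>
      minv Z *\<^sub>v (wadjoint M N A *\<^sub>v w) = (gsvd_Sigma m n r \<sigma>)\<^sup>T *\<^sub>v (U\<^sub>A\<^sup>T *\<^sub>v (L\<^sub>M *\<^sub>v w))"
proof -
  let ?S = "gsvd_Sigma m n r \<sigma>"
  have S: "?S \<in> carrier_mat m n" by (simp add: gsvd_Sigma_def)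
  have L: "L\<^sub>M \<in> carrier_mat m m" and Minv: "minv M = L\<^sub>M\<^sup>T * L\<^sub>M"
    using L\<^sub>M by (simp_all add: cholesky_def)
  have U: "U\<^sub>A \<in> carrier_mat m m" "U\<^sub>A\<^sup>T * U\<^sub>A = 1\<^sub>m m"
    and Z: "Z \<in> carrier_mat n n" and ortho: "Z\<^sup>T * minv N * Z = 1\<^sub>m n"
    and LA: "L\<^sub>M * A = U\<^sub>A * ?S * minv Z"
    using gsvd by (simp_all add: normalized_gsvd_def orthonormal_mat_def)
  have Nc: "N \<in> carrier_mat n n" using N by (simp add: sym_pos_def_def)
  note W = weighted_inverse_gsvd[OF N Z ortho]
  have US: "U\<^sub>A * ?S \<in> carrier_mat m n" using U S by auto
  have "U\<^sub>A\<^sup>T * (L\<^sub>M * A) = U\<^sub>A\<^sup>T * (U\<^sub>A * (?S * minv Z))"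
    unfolding LA using assoc_mult_mat[OF U(1) S W(1)] by simp
  also have "\<dots> = (U\<^sub>A\<^sup>T * U\<^sub>A) * (?S * minv Z)"
    using U S W(1) by (intro assoc_mult_mat[symmetric]) auto
  finally have UTLA: "U\<^sub>A\<^sup>T * (L\<^sub>M * A) = ?S * minv Z"
    using U S W(1) by simp
  show "U\<^sub>A\<^sup>T *\<^sub>v (L\<^sub>M *\<^sub>v (A *\<^sub>v x)) = ?S *\<^sub>v (minv Z *\<^sub>v x)" if x: "x \<in> carrier_vec n"
  proof -
    have "U\<^sub>A\<^sup>T *\<^sub>v (L\<^sub>M *\<^sub>v (A *\<^sub>v x)) = (U\<^sub>A\<^sup>T * (L\<^sub>M * A)) *\<^sub>v x"
      using assoc_mult_mat_vec[of "U\<^sub>A\<^sup>T" m m "L\<^sub>M * A" n x] assoc_mult_mat_vec[OF L A x] U L A x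
      by simp
    also have "\<dots> = ?S *\<^sub>v (minv Z *\<^sub>v x)"
      unfolding UTLA by (rule assoc_mult_mat_vec[OF S W(1) x])
    finally show ?thesis .
  qed
  have "L\<^sub>M * A * Z = U\<^sub>A * ?S * (minv Z * Z)"
    unfolding LA by (rule assoc_mult_mat[OF US W(1) Z])
  then have LAZ: "L\<^sub>M * A * Z = U\<^sub>A * ?S" unfolding W(3) right_mult_one_mat[OF US] .
  have "minv Z * wadjoint M N A = Z\<^sup>T * A\<^sup>T * L\<^sub>M\<^sup>T * L\<^sub>M"
  proof -
    have c: "Z\<^sup>T \<in> carrier_mat n n" "A\<^sup>T \<in> carrier_mat n m" "L\<^sub>M\<^sup>T \<in> carrier_mat m m"
        "N * A\<^sup>T \<in> carrier_mat n m" "L\<^sub>M\<^sup>T * L\<^sub>M \<in> carrier_mat m m" "Z\<^sup>T * A\<^sup>T \<in> carrier_mat n m"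
      using Z A L Nc by auto
    have "minv Z * wadjoint M N A = minv Z * (N * A\<^sup>T) * (L\<^sub>M\<^sup>T * L\<^sub>M)"
      unfolding wadjoint_def Minv by (rule assoc_mult_mat[OF W(1) c(4,5), symmetric])
    also have "minv Z * (N * A\<^sup>T) = Z\<^sup>T * A\<^sup>T"
      unfolding W(4)[symmetric] by (rule assoc_mult_mat[OF W(1) Nc c(2), symmetric])
    also have "Z\<^sup>T * A\<^sup>T * (L\<^sub>M\<^sup>T * L\<^sub>M) = Z\<^sup>T * A\<^sup>T * L\<^sub>M\<^sup>T * L\<^sub>M"
      by (rule assoc_mult_mat[OF c(6,3) L, symmetric])
    finally show ?thesis .
  qed
  also have "Z\<^sup>T * A\<^sup>T * L\<^sub>M\<^sup>T = (L\<^sub>M * A * Z)\<^sup>T"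
    using Z A L by (simp add: transpose_mult[of _ m n _ n] transpose_mult[of _ m m _ n]
        assoc_mult_mat[of _ n n _ m _ m])
  also have "\<dots> = ?S\<^sup>T * U\<^sub>A\<^sup>T" unfolding LAZ by (rule transpose_mult[OF U(1) S])
  finally have adj: "minv Z * wadjoint M N A = ?S\<^sup>T * U\<^sub>A\<^sup>T * L\<^sub>M" .
  have wa: "wadjoint M N A \<in> carrier_mat n m" using Nc A L by (auto simp: wadjoint_def Minv)
  show "minv Z *\<^sub>v (wadjoint M N A *\<^sub>v w) = ?S\<^sup>T *\<^sub>v (U\<^sub>A\<^sup>T *\<^sub>v (L\<^sub>M *\<^sub>v w))"
    if w: "w \<in> carrier_vec m"
  proof -
    have "minv Z *\<^sub>v (wadjoint M N A *\<^sub>v w) = (?S\<^sup>T * U\<^sub>A\<^sup>T * L\<^sub>M) *\<^sub>v w"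
      unfolding adj[symmetric] by (rule assoc_mult_mat_vec[OF W(1) wa w, symmetric])
    also have "\<dots> = (?S\<^sup>T * U\<^sub>A\<^sup>T) *\<^sub>v (L\<^sub>M *\<^sub>v w)"
      using U S L w by (intro assoc_mult_mat_vec) auto
    also have "\<dots> = ?S\<^sup>T *\<^sub>v (U\<^sub>A\<^sup>T *\<^sub>v (L\<^sub>M *\<^sub>v w))"
      using U S L w by (intro assoc_mult_mat_vec) auto
    finally show ?thesis .
  qed
qed

text \<open>Elimination of \<open>q\<close> leaves for \<open>p\<close> the three-term recurrence that defines \<open>gkb_poly\<close>, at the point
  \<open>s\<^sup>2\<close>. The sequences \<open>p\<close> and \<open>q\<close> stand for one fixed coordinate of the vectors \<open>v\<^sub>i\<close> and \<open>u\<^sub>i\<close>,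
  and \<open>s\<close> for the corresponding diagonal entry.\<close>

lemma coupled_recurrence_polynomial:
  fixes p q :: "nat \<Rightarrow> real"
  assumes nz: "\<forall>i\<in>{1..l}. \<alpha> i \<noteq> 0 \<and> \<beta> i \<noteq> 0" and p0: "p 0 = 0"
    and p: "\<forall>i\<in>{1..l}. \<alpha> i * p i = s * q i - \<beta> i * p (i - 1)"
    and q: "\<forall>i\<in>{1..<l}. \<beta> (i + 1) * q (i + 1) = s * p i - \<alpha> i * q i"
  shows "i \<le> l \<Longrightarrow> p i = poly (gkb_poly \<alpha> \<beta> i) (s\<^sup>2) * p 1"
proof (induction i rule: less_induct)
  case (less i)
  show ?case
  proof (cases "i \<le> 1")
    case True
    then show ?thesis using p0 by (cases i) (auto simp: gkb_poly_def)
  next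
    case False
    then obtain h where i: "i = h + 1" and h: "1 \<le> h" by (intro that[of "i - 1"]) auto
    let ?P = "\<lambda>i. poly (gkb_poly \<alpha> \<beta> i) (s\<^sup>2)"
    have IH: "p h = ?P h * p 1" "p (h - 1) = ?P (h - 1) * p 1"
      using less.IH[of h] less.IH[of "h - 1"] less.prems i h by auto
    have ph: "\<alpha> h * p h = s * q h - \<beta> h * p (h - 1)"
      and ph1: "\<alpha> (h + 1) * p (h + 1) = s * q (h + 1) - \<beta> (h + 1) * p h"
      and qh: "\<beta> (h + 1) * q (h + 1) = s * p h - \<alpha> h * q h"
      using p q less.prems i h by (auto dest!: bspec[of _ _ "h + 1"])
    have b: "\<alpha> (h + 1) * \<beta> (h + 1) \<noteq> 0" using nz less.prems i by auto
    have "\<alpha> (h + 1) * \<beta> (h + 1) * p (h + 1) = \<beta> (h + 1) * (s * q (h + 1) - \<beta> (h + 1) * p h)"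
      using ph1 by (simp add: mult.assoc mult.left_commute)
    also have "\<dots> = s * (\<beta> (h + 1) * q (h + 1)) - (\<beta> (h + 1))\<^sup>2 * p h"
      by (simp add: algebra_simps power2_eq_square)
    also have "\<dots> = s\<^sup>2 * p h - \<alpha> h * (s * q h) - (\<beta> (h + 1))\<^sup>2 * p h"
      unfolding qh by (simp add: algebra_simps power2_eq_square)
    also have "s * q h = \<alpha> h * p h + \<beta> h * p (h - 1)" using ph by simp
    also have "s\<^sup>2 * p h - \<alpha> h * (\<alpha> h * p h + \<beta> h * p (h - 1)) - (\<beta> (h + 1))\<^sup>2 * p h =
        ((s\<^sup>2 - ((\<alpha> h)\<^sup>2 + (\<beta> (h + 1))\<^sup>2)) * ?P h - \<alpha> h * \<beta> h * ?P (h - 1)) * p 1"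
      unfolding IH by (simp add: algebra_simps power2_eq_square)
    also have "\<dots> = \<alpha> (h + 1) * \<beta> (h + 1) * ?P (h + 1) * p 1"
      using poly_three_term_recurrence[of h "gram_off \<alpha> \<beta>" "gram_diag \<alpha> \<beta>" "s\<^sup>2"] h b
      by (simp add: gkb_poly_def gram_off_def gram_diag_def del: three_term_poly.simps)
    finally show ?thesis using b i by simp
  qed
qed

lemma mat_of_cols_mult_vec_index:
  assumes "y \<in> carrier_vec k" and "l < n"
  shows "(mat_of_cols n (map v [1..<k + 1]) *\<^sub>v y) $ l = (\<Sum>j<k. v (j + 1) $ l * y $ j)"
proof -
  have "(mat_of_cols n (map v [1..<k + 1]) *\<^sub>v y) $ l =
      (\<Sum>j = 0..<k. mat_of_cols n (map v [1..<k + 1]) $$ (l, j) * y $ j)"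
    using assms by (simp add: scalar_prod_def del: upt_Suc)
  also have "\<dots> = (\<Sum>j<k. v (j + 1) $ l * y $ j)"
    using assms by (intro sum.cong) (auto simp: mat_of_cols_def simp del: upt_Suc)
  finally show ?thesis .
qed

lemma spr_coeffs_carrier:
  assumes "\<forall>i\<in>{1..k}. \<alpha> i \<noteq> 0"
  shows "spr_coeffs k \<alpha> \<beta> \<in> carrier_vec k"
proof -
  have "x = 0\<^sub>v k" if "x \<in> carrier_vec k" "bidiag k \<alpha> \<beta> *\<^sub>v x = 0\<^sub>v (k + 1)" for x
    using bidiag_injective[of k \<alpha> x \<beta>] assms that by auto
  from least_squares_normal_equations(1)[OF bidiag_carrier _ this]
  show ?thesis unfolding spr_coeffs_def by auto
qed

text \<open>As \<open>\<Sigma>\<^sub>A\<close> is diagonal, gen-GKB decouples into scalar recurrences, one for each coordinate. The starting value is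
  \<open>\<alpha>\<^sub>1 \<beta>\<^sub>1 Z\<^sup>-\<^sup>1 v\<^sub>1 = \<Sigma>\<^sub>A\<^sup>T U\<^sub>A\<^sup>T L\<^sub>M b\<close>. Beyond the rank, the diagonal entry is zero, so the coordinates
  of the \<open>v\<^sub>i\<close> vanish.\<close>

lemma gkb_gsvd_coordinate:
  fixes A M N L\<^sub>M L\<^sub>N U\<^sub>A U\<^sub>L Z :: "real mat" and u v :: "nat \<Rightarrow> real vec"
  assumes A: "A \<in> carrier_mat m n" and rm: "r \<le> m" and rn: "r \<le> n"
    and N: "sym_pos_def n N" and L\<^sub>M: "cholesky m (minv M) L\<^sub>M"
    and gsvd: "normalized_gsvd m n r N (L\<^sub>M * A) L\<^sub>N U\<^sub>A U\<^sub>L \<sigma> Z"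
    and gkb: "gen_gkb m n A b M N l u v \<alpha> \<beta>" and l: "1 \<le> l"
    and nz: "\<forall>i\<in>{1..l}. \<alpha> i \<noteq> 0 \<and> \<beta> i \<noteq> 0"
    and h: "h < n" and i: "i \<le> l"
  shows "(minv Z *\<^sub>v v i) $ h =
    (if h < r then poly (gkb_poly \<alpha> \<beta> i) ((\<sigma> (h + 1))\<^sup>2) * (\<sigma> (h + 1) * (col U\<^sub>A h \<bullet> (L\<^sub>M *\<^sub>v b)) / (\<alpha> 1 * \<beta> 1))
     else 0)"
proof -
  have Z: "Z \<in> carrier_mat n n" and ortho: "Z\<^sup>T * minv N * Z = 1\<^sub>m n"
    and U: "U\<^sub>A \<in> carrier_mat m m"
    using gsvd by (simp_all add: normalized_gsvd_def orthonormal_mat_def)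
  have L: "L\<^sub>M \<in> carrier_mat m m" and Minv: "minv M = L\<^sub>M\<^sup>T * L\<^sub>M"
    using L\<^sub>M by (simp_all add: cholesky_def)
  have Nc: "N \<in> carrier_mat n n" using N by (simp add: sym_pos_def_def)
  have wa: "wadjoint M N A \<in> carrier_mat n m" using Nc A L by (auto simp: wadjoint_def Minv)
  note W = weighted_inverse_gsvd(1)[OF N Z ortho]
  note coords = gsvd_coordinates[OF A N L\<^sub>M gsvd]
  define p where "p i = minv Z *\<^sub>v v i" for i
  define q where "q i = U\<^sub>A\<^sup>T *\<^sub>v (L\<^sub>M *\<^sub>v u i)" for i
  have v0: "v 0 = 0\<^sub>v n" and b1: "\<beta> 1 \<cdot>\<^sub>v u 1 = b"
    and uv: "i \<in> {1..l} \<Longrightarrow> u i \<in> carrier_vec m" "i \<in> {1..l} \<Longrightarrow> v i \<in> carrier_vec n"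
    and rv: "i \<in> {1..l} \<Longrightarrow> \<alpha> i \<cdot>\<^sub>v v i = wadjoint M N A *\<^sub>v u i - \<beta> i \<cdot>\<^sub>v v (i - 1)"
    and ru: "i \<in> {1..<l} \<Longrightarrow> \<beta> (i + 1) \<cdot>\<^sub>v u (i + 1) = A *\<^sub>v v i - \<alpha> i \<cdot>\<^sub>v u i" for i
    using gkb unfolding gen_gkb_def by blast+
  have vc: "v i \<in> carrier_vec n" if "i \<le> l" for i
    using that uv(2)[of i] v0 by (cases "i = 0") auto
  have pc: "p i \<in> carrier_vec n" if "i \<le> l" for i
    unfolding p_def using W vc[OF that] by auto
  have UT: "U\<^sub>A\<^sup>T \<in> carrier_mat m m" using U by simp
  have Lu: "L\<^sub>M *\<^sub>v u i \<in> carrier_vec m" if "i \<in> {1..l}" for i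
    by (rule mult_mat_vec_carrier[OF L uv(1)[OF that]])
  have qc: "q i \<in> carrier_vec m" if "i \<in> {1..l}" for i
    unfolding q_def by (rule mult_mat_vec_carrier[OF UT Lu[OF that]])
  have p_step: "\<alpha> i \<cdot>\<^sub>v p i = (gsvd_Sigma m n r \<sigma>)\<^sup>T *\<^sub>v q i - \<beta> i \<cdot>\<^sub>v p (i - 1)"
    if i: "i \<in> {1..l}" for i
  proof -
    have v': "v i \<in> carrier_vec n" "v (i - 1) \<in> carrier_vec n" using i by (auto intro: vc)
    have "\<alpha> i \<cdot>\<^sub>v p i = minv Z *\<^sub>v (\<alpha> i \<cdot>\<^sub>v v i)"
      unfolding p_def by (rule mult_mat_vec[OF W v'(1), symmetric])
    also have "\<dots> = minv Z *\<^sub>v (wadjoint M N A *\<^sub>v u i) - minv Z *\<^sub>v (\<beta> i \<cdot>\<^sub>v v (i - 1))"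
      unfolding rv[OF i] using W v' mult_mat_vec_carrier[OF wa uv(1)[OF i]]
      by (intro mult_minus_distrib_mat_vec) auto
    also have "minv Z *\<^sub>v (\<beta> i \<cdot>\<^sub>v v (i - 1)) = \<beta> i \<cdot>\<^sub>v p (i - 1)"
      unfolding p_def by (rule mult_mat_vec[OF W v'(2)])
    also have "minv Z *\<^sub>v (wadjoint M N A *\<^sub>v u i) = (gsvd_Sigma m n r \<sigma>)\<^sup>T *\<^sub>v q i"
      unfolding q_def by (rule coords(2)[OF uv(1)[OF i]])
    finally show ?thesis .
  qed
  have q_step: "\<beta> (i + 1) \<cdot>\<^sub>v q (i + 1) = gsvd_Sigma m n r \<sigma> *\<^sub>v p i - \<alpha> i \<cdot>\<^sub>v q i"
    if i: "i \<in> {1..<l}" for i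
  proof -
    have i': "i \<in> {1..l}" "i + 1 \<in> {1..l}" using i by auto
    have Av: "A *\<^sub>v v i \<in> carrier_vec m" by (rule mult_mat_vec_carrier[OF A uv(2)[OF i'(1)]])
    have au: "\<alpha> i \<cdot>\<^sub>v u i \<in> carrier_vec m" using uv(1)[OF i'(1)] by simp
    have "\<beta> (i + 1) \<cdot>\<^sub>v q (i + 1) = U\<^sub>A\<^sup>T *\<^sub>v (L\<^sub>M *\<^sub>v (\<beta> (i + 1) \<cdot>\<^sub>v u (i + 1)))"
      unfolding q_def mult_mat_vec[OF L uv(1)[OF i'(2)]] by (rule mult_mat_vec[OF UT Lu[OF i'(2)], symmetric])
    also have "\<dots> = U\<^sub>A\<^sup>T *\<^sub>v (L\<^sub>M *\<^sub>v (A *\<^sub>v v i)) - U\<^sub>A\<^sup>T *\<^sub>v (L\<^sub>M *\<^sub>v (\<alpha> i \<cdot>\<^sub>v u i))"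
      unfolding ru[OF i] mult_minus_distrib_mat_vec[OF L Av au]
      by (rule mult_minus_distrib_mat_vec[OF UT mult_mat_vec_carrier[OF L Av] mult_mat_vec_carrier[OF L au]])
    also have "U\<^sub>A\<^sup>T *\<^sub>v (L\<^sub>M *\<^sub>v (\<alpha> i \<cdot>\<^sub>v u i)) = \<alpha> i \<cdot>\<^sub>v q i"
      unfolding q_def mult_mat_vec[OF L uv(1)[OF i'(1)]] by (rule mult_mat_vec[OF UT Lu[OF i'(1)]])
    also have "U\<^sub>A\<^sup>T *\<^sub>v (L\<^sub>M *\<^sub>v (A *\<^sub>v v i)) = gsvd_Sigma m n r \<sigma> *\<^sub>v p i"
      unfolding p_def by (rule coords(1)[OF uv(2)[OF i'(1)]])
    finally show ?thesis .
  qed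
  have p0: "p 0 $ h = 0" unfolding p_def v0 using W h by auto
  have p_rec: "\<alpha> i * p i $ h = (if h < r then \<sigma> (h + 1) * q i $ h else 0) - \<beta> i * p (i - 1) $ h"
    if i: "i \<in> {1..l}" for i
  proof -
    have "p i \<in> carrier_vec n" "p (i - 1) \<in> carrier_vec n" using i by (auto intro: pc)
    then show ?thesis
      using arg_cong[OF p_step[OF i], of "\<lambda>x. vec_index x h"] h
        gsvd_Sigma_transpose_mult_vec_index[OF qc[OF i] h rm, of \<sigma>] by auto
  qed
  show ?thesis
  proof (cases "h < r")
    case True
    have q_rec: "\<beta> (i + 1) * q (i + 1) $ h = \<sigma> (h + 1) * p i $ h - \<alpha> i * q i $ h"
      if i: "i \<in> {1..<l}" for i
    proof -
      have "q (i + 1) \<in> carrier_vec m" "q i \<in> carrier_vec m" "p i \<in> carrier_vec n"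
        using i by (auto intro!: qc pc)
      then show ?thesis
        using arg_cong[OF q_step[OF i], of "\<lambda>x. vec_index x h"] True rm
          gsvd_Sigma_mult_vec_index[OF _ True rn rm, of "p i" \<sigma>] by auto
    qed
    have pi: "p i $ h = poly (gkb_poly \<alpha> \<beta> i) ((\<sigma> (h + 1))\<^sup>2) * p 1 $ h"
      using coupled_recurrence_polynomial[of l \<alpha> \<beta> "\<lambda>i. p i $ h" "\<sigma> (h + 1)" "\<lambda>i. q i $ h" i]
        nz p0 p_rec q_rec i True by simp
    have p1: "\<alpha> 1 * p 1 $ h = \<sigma> (h + 1) * q 1 $ h" using p_rec[of 1] p0 l True by simp
    have q1: "\<beta> 1 * q 1 $ h = col U\<^sub>A h \<bullet> (L\<^sub>M *\<^sub>v b)"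
    proof -
      have "U\<^sub>A\<^sup>T *\<^sub>v (L\<^sub>M *\<^sub>v b) = \<beta> 1 \<cdot>\<^sub>v q 1"
        unfolding q_def b1[symmetric] using L UT uv(1)[of 1] Lu[of 1] l
        by (simp add: mult_mat_vec[of _ m m])
      from arg_cong[OF this, of "\<lambda>x. vec_index x h"] show ?thesis
        using qc[of 1] l True rm U by simp
    qed
    have "(\<alpha> 1 * \<beta> 1) * p 1 $ h = \<beta> 1 * (\<alpha> 1 * p 1 $ h)" by simp
    also have "\<dots> = \<sigma> (h + 1) * (\<beta> 1 * q 1 $ h)" unfolding p1 by simp
    finally have "(\<alpha> 1 * \<beta> 1) * p 1 $ h = \<sigma> (h + 1) * (col U\<^sub>A h \<bullet> (L\<^sub>M *\<^sub>v b))" unfolding q1 .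
    moreover have "\<alpha> 1 * \<beta> 1 \<noteq> 0" using nz l by auto
    ultimately have "p 1 $ h = \<sigma> (h + 1) * (col U\<^sub>A h \<bullet> (L\<^sub>M *\<^sub>v b)) / (\<alpha> 1 * \<beta> 1)"
      by (metis nonzero_mult_div_cancel_left)
    then show ?thesis using pi True by (simp add: p_def)
  next
    case False
    have "p i $ h = 0"
      using i
    proof (induction i)
      case (Suc i)
      then show ?case using p_rec[of "Suc i"] nz False by auto
    qed (rule p0)
    then show ?thesis using False by (simp add: p_def)
  qed
qed

section \<open>The filtered expansion\<close>

lemma prod_singular_values:
  fixes g :: "real \<Rightarrow> real"
  assumes nz: "\<forall>i\<in>{1..k + 1}. \<alpha> i \<noteq> 0 \<and> \<beta> i \<noteq> 0" and k: "k \<ge> 1"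
  defines "\<theta>s \<equiv> singular_values (bidiag k \<alpha> \<beta>)"
  shows "(\<Prod>j = 1..k. g ((\<theta>s ! (j - 1))\<^sup>2)) = (\<Prod>t\<in>{t. poly (gkb_poly \<alpha> \<beta> (k + 1)) t = 0}. g t)"
proof -
  note sv = singular_values_bidiag[OF nz k, folded \<theta>s_def]
  have "distinct \<theta>s" unfolding distinct_conv_nth
    using sorted_wrt_nth_less[OF sv(2)] by (metis less_irrefl nat_neq_iff)
  have "(\<Prod>j = 1..k. g ((\<theta>s ! (j - 1))\<^sup>2)) = (\<Prod>j<k. g ((\<theta>s ! j)\<^sup>2))"
    by (rule prod.reindex_bij_witness[of _ Suc "\<lambda>j. j - 1"]) auto
  also have "\<dots> = (\<Prod>x\<in>set \<theta>s. g (x\<^sup>2))"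
    by (rule prod.reindex_bij_betw[OF bij_betw_nth[OF \<open>distinct \<theta>s\<close>]]) (simp_all add: sv(1))
  also have "\<dots> = (\<Prod>t\<in>{t. poly (gkb_poly \<alpha> \<beta> (k + 1)) t = 0}. g t)"
    by (rule prod.reindex_bij_betw[OF sv(4)])
  finally show ?thesis .
qed

lemma mult_mat_vec_eq_finsum_col:
  fixes Z :: "real mat" and x :: "real vec"
  assumes Z: "Z \<in> carrier_mat n n" and x: "x \<in> carrier_vec n" and r: "r \<le> n"
    and c: "\<And>i. i \<in> {1..r} \<Longrightarrow> c i = x $ (i - 1)"
    and zero: "\<And>h. r \<le> h \<Longrightarrow> h < n \<Longrightarrow> x $ h = 0"
  shows "Z *\<^sub>v x = finsum_vec TYPE(real) n (\<lambda>i. c i \<cdot>\<^sub>v col Z (i - 1)) {1..r}" (is "_ = ?sum")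
proof (rule eq_vecI)
  have cols: "(\<lambda>i. c i \<cdot>\<^sub>v col Z (i - 1)) \<in> {1..r} \<rightarrow> carrier_vec n" using Z by auto
  show "dim_vec (Z *\<^sub>v x) = dim_vec ?sum"
    using Z finsum_vec_closed[OF cols] by auto
  fix j assume "j < dim_vec ?sum"
  then have j: "j < n" using finsum_vec_closed[OF cols] by auto
  have "(Z *\<^sub>v x) $ j = (\<Sum>h\<in>{0..<n}. Z $$ (j, h) * x $ h)"
    using Z x j by (auto simp: scalar_prod_def intro!: sum.cong)
  also have "\<dots> = (\<Sum>h\<in>{0..<r}. Z $$ (j, h) * x $ h)"
    using r zero by (intro sum.mono_neutral_right) auto
  also have "\<dots> = (\<Sum>i\<in>{1..r}. (c i \<cdot>\<^sub>v col Z (i - 1)) $ j)"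
    using Z j r c by (intro sum.reindex_bij_witness[of _ "\<lambda>i. i - 1" Suc]) auto
  also have "\<dots> = ?sum $ j"
    by (rule index_finsum_vec[symmetric]) (use j cols in auto)
  finally show "(Z *\<^sub>v x) $ j = ?sum $ j" .
qed

theorem theorem4p3:
  fixes A M N L\<^sub>M L\<^sub>N U\<^sub>A U\<^sub>L Z :: "real mat" and b :: "real vec"
    and m n r k :: nat
    and \<sigma> \<gamma> \<alpha> \<beta> :: "nat \<Rightarrow> real" and u v :: "nat \<Rightarrow> real vec"
  assumes A: "A \<in> carrier_mat m n" and rank_A: "vec_space.rank m A = r"
    and b: "b \<in> carrier_vec m"
    and M: "sym_pos_def m M" and N: "sym_pos_def n N"
    and L\<^sub>M: "cholesky m (minv M) L\<^sub>M" and L\<^sub>N: "cholesky n (minv N) L\<^sub>N"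
    and gsvd: "normalized_gsvd m n r N (L\<^sub>M * A) L\<^sub>N U\<^sub>A U\<^sub>L \<sigma> Z"
    and \<gamma>: "\<forall>i\<in>{1..r}. \<gamma> i = \<sigma> i"
    and k: "k \<ge> 1"
    and gkb: "gen_gkb m n A b M N (k + 1) u v \<alpha> \<beta>"
    and no_termination: "\<forall>i\<in>{1..k + 1}. \<alpha> i \<noteq> 0 \<and> \<beta> i \<noteq> 0"
  shows "let
      \<theta>s = singular_values (bidiag k \<alpha> \<beta>);
      \<theta> = (\<lambda>j. \<theta>s ! (j - 1));
      f = (\<lambda>i. 1 - (\<Prod>j = 1..k. ((\<theta> j)\<^sup>2 - (\<gamma> i)\<^sup>2) / (\<theta> j)\<^sup>2))
    in length \<theta>s = k \<and> (\<forall>j\<in>{1..<k}. \<theta> j > \<theta> (j + 1)) \<and> (\<forall>j\<in>{1..k}. \<theta> j > 0) \<and>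
       genGKB_SPR n k v \<alpha> \<beta> =
         finsum_vec TYPE(real) n
           (\<lambda>i. (f i * (col U\<^sub>A (i - 1) \<bullet> (L\<^sub>M *\<^sub>v b)) / \<sigma> i) \<cdot>\<^sub>v col Z (i - 1)) {1..r}"
proof -
  define \<theta>s where "\<theta>s = singular_values (bidiag k \<alpha> \<beta>)"
  define f where "f i = 1 - (\<Prod>j = 1..k. ((\<theta>s ! (j - 1))\<^sup>2 - (\<gamma> i)\<^sup>2) / (\<theta>s ! (j - 1))\<^sup>2)" for i
  define x where "x = genGKB_SPR n k v \<alpha> \<beta>"
  let ?P = "gkb_poly \<alpha> \<beta>" and ?y = "spr_coeffs k \<alpha> \<beta>"
  note sv = singular_values_bidiag[OF no_termination k, folded \<theta>s_def]
  have rm: "r \<le> m" and rn: "r \<le> n"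
    using vec_space.rank_le_nr[OF A] vec_space.rank_le_nc[OF A] rank_A by auto
  have Z: "Z \<in> carrier_mat n n" and ortho: "Z\<^sup>T * minv N * Z = 1\<^sub>m n"
    and \<sigma>: "\<forall>i\<in>{1..r}. \<sigma> i > 0"
    using gsvd by (simp_all add: normalized_gsvd_def)
  note W = weighted_inverse_gsvd[OF N Z ortho]
  have y: "?y \<in> carrier_vec k" using no_termination by (intro spr_coeffs_carrier) auto
  have V: "mat_of_cols n (map v [1..<k + 1]) \<in> carrier_mat n k"
    by (simp add: mat_of_cols_def del: upt_Suc)
  have x: "x \<in> carrier_vec n" unfolding x_def genGKB_SPR_def using V y by auto
  have vc: "v (j + 1) \<in> carrier_vec n" if "j < k" for j
    using gkb that by (auto simp: gen_gkb_def)
  have coord: "(minv Z *\<^sub>v x) $ h = (\<Sum>j<k. (minv Z *\<^sub>v v (j + 1)) $ h * ?y $ j)" if h: "h < n" for h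
  proof -
    have "(minv Z *\<^sub>v x) $ h = (\<Sum>l = 0..<n. minv Z $$ (h, l) * x $ l)"
      using W(1) x h by (auto simp: scalar_prod_def intro!: sum.cong)
    also have "\<dots> = (\<Sum>l = 0..<n. \<Sum>j<k. minv Z $$ (h, l) * v (j + 1) $ l * ?y $ j)"
      unfolding x_def genGKB_SPR_def
      by (intro sum.cong refl, subst mat_of_cols_mult_vec_index[OF y])
        (simp_all add: sum_distrib_left mult.assoc)
    also have "\<dots> = (\<Sum>j<k. (\<Sum>l = 0..<n. minv Z $$ (h, l) * v (j + 1) $ l) * ?y $ j)"
      by (subst sum.swap) (simp add: sum_distrib_right)
    also have "\<dots> = (\<Sum>j<k. (minv Z *\<^sub>v v (j + 1)) $ h * ?y $ j)"
    proof (intro sum.cong refl arg_cong2[of _ _ _ _ "(*)"])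
      fix j assume "j \<in> {..<k}"
      then show "(\<Sum>l = 0..<n. minv Z $$ (h, l) * v (j + 1) $ l) = (minv Z *\<^sub>v v (j + 1)) $ h"
        using W(1) h vc[of j] by (auto simp: scalar_prod_def intro!: sum.cong)
    qed
    finally show ?thesis .
  qed
  note vcoord = gkb_gsvd_coordinate[OF A rm rn N L\<^sub>M gsvd gkb _ no_termination]
  have zero: "(minv Z *\<^sub>v x) $ h = 0" if "r \<le> h" "h < n" for h
    using that by (simp add: coord vcoord)
  \<comment> \<open>Here \<open>t Q(t)\<close> may be divided by \<open>t = \<sigma>\<^sub>i\<^sup>2\<close>, which is positive up to the rank.\<close>
  have filt: "(minv Z *\<^sub>v x) $ (i - 1) = f i * (col U\<^sub>A (i - 1) \<bullet> (L\<^sub>M *\<^sub>v b)) / \<sigma> i"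
    if i: "i \<in> {1..r}" for i
  proof -
    let ?c = "col U\<^sub>A (i - 1) \<bullet> (L\<^sub>M *\<^sub>v b)"
    have "\<sigma> i > 0" using \<sigma> i by blast
    then have s: "\<sigma> i \<noteq> 0" "\<gamma> i = \<sigma> i" using \<gamma> i by auto
    have nz1: "\<alpha> 1 * \<beta> 1 \<noteq> 0" using no_termination by simp
    have "f i = 1 - (\<Prod>t\<in>{t. poly (?P (k + 1)) t = 0}. (t - (\<sigma> i)\<^sup>2) / t)"
      unfolding f_def \<theta>s_def s(2)
      using prod_singular_values[OF no_termination k, of "\<lambda>t. (t - (\<sigma> i)\<^sup>2) / t"] by simp
    also have "\<dots> = 1 - poly (?P (k + 1)) ((\<sigma> i)\<^sup>2) / poly (?P (k + 1)) 0"
      using gkb_poly_ratio[OF no_termination k, of "(\<sigma> i)\<^sup>2"] by simp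
    finally have "\<alpha> 1 * \<beta> 1 * f i = (\<sigma> i)\<^sup>2 * (\<Sum>j<k. poly (?P (j + 1)) ((\<sigma> i)\<^sup>2) * ?y $ j)"
      using projected_solution_polynomial[OF no_termination k, of "(\<sigma> i)\<^sup>2"] by simp
    then have sum: "(\<Sum>j<k. poly (?P (j + 1)) ((\<sigma> i)\<^sup>2) * ?y $ j) = \<alpha> 1 * \<beta> 1 * f i / (\<sigma> i)\<^sup>2"
      using s by (simp add: field_simps)
    have "(minv Z *\<^sub>v x) $ (i - 1) =
        (\<Sum>j<k. poly (?P (j + 1)) ((\<sigma> i)\<^sup>2) * (\<sigma> i * ?c / (\<alpha> 1 * \<beta> 1)) * ?y $ j)"
      using i rn by (subst coord) (auto simp: vcoord intro!: sum.cong)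
    also have "\<dots> = (\<Sum>j<k. poly (?P (j + 1)) ((\<sigma> i)\<^sup>2) * ?y $ j) * (\<sigma> i * ?c / (\<alpha> 1 * \<beta> 1))"
      unfolding sum_distrib_right by (intro sum.cong) (simp_all add: mult_ac)
    also have "\<dots> = f i * ?c / \<sigma> i"
      unfolding sum using s nz1 by (simp add: power2_eq_square)
    finally show ?thesis .
  qed
  have Wx: "minv Z *\<^sub>v x \<in> carrier_vec n" by (rule mult_mat_vec_carrier[OF W(1) x])
  have "x = Z *\<^sub>v (minv Z *\<^sub>v x)"
    using assoc_mult_mat_vec[OF Z W(1) x] W(2) x by simp
  also have "\<dots> = finsum_vec TYPE(real) n
      (\<lambda>i. (f i * (col U\<^sub>A (i - 1) \<bullet> (L\<^sub>M *\<^sub>v b)) / \<sigma> i) \<cdot>\<^sub>v col Z (i - 1)) {1..r}"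
    by (rule mult_mat_vec_eq_finsum_col[OF Z Wx rn filt[symmetric] zero])
  finally have "genGKB_SPR n k v \<alpha> \<beta> = finsum_vec TYPE(real) n
      (\<lambda>i. (f i * (col U\<^sub>A (i - 1) \<bullet> (L\<^sub>M *\<^sub>v b)) / \<sigma> i) \<cdot>\<^sub>v col Z (i - 1)) {1..r}"
    by (simp add: x_def)
  moreover have "\<forall>j\<in>{1..<k}. \<theta>s ! (j - 1) > \<theta>s ! (j + 1 - 1)"
    using sv(1,2) by (auto simp: sorted_wrt_iff_nth_less)
  moreover have "\<forall>j\<in>{1..k}. \<theta>s ! (j - 1) > 0"
    using sv(1,3) by auto
  ultimately show ?thesis
    unfolding Let_def f_def \<theta>s_def using sv(1) by (simp add: \<theta>s_def)
qed

end
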